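(* Let $Q$ be a compact Hausdorff space, let $n$ be an arbitrary infinite cardinal number, let $F=\mathbb{R}$ or $F=\mathbb{H}$ (the quaternions), and let $C(Q, M_n(F))$ be the algebra of all continuous maps from $Q$ to $M_n(F)$. Let $\bigtriangleup : C(Q, M_n(F)) \to C(Q, M_n(F))$ be a 2-local derivation (not assumed linear). Then $\bigtriangleup$ is a derivation.
   Context: Let $\Xi$ be an index set of cardinality $n$ (an infinite cardinal). For $i,j\in\Xi$ let $e_{ij}$ be the $\Xi\times\Xi$ matrix with $1$ in position $(i,j)$ and $0$ elsewhere. For $F=\mathbb{R}$ or $\mathbb{H}$, $M_n(F)$ is the set of all matrices $\{\lambda^{ij}e_{ij}\}_{i,j\in\Xi}$ with $\lambda^{ij}\in F$ for which there is a number $K\in\mathbb{R}$ such that every finite square submatrix (indexed by a finite subset of $\Xi$) has operator norm at most $K$. With entrywise linear operations, the usual matrix product $\{\lambda^{ij}e_{ij}\}\{\mu^{ij}e_{ij}\}=\{\sum_{\xi\in\Xi}\lambda^{i\xi}\mu^{\xi j}e_{ij}\}$, and the norm equal to the supremum of the operator norms of the finite square submatrices, $M_n(F)$ is identified with the algebra $B(l_2(\Xi))$ of all bounded linear operators on the Hilbert space $l_2(\Xi)$ over $F$. Both $M_n(\mathbb{R})$ and $M_n(\mathbb{H})$ are regarded as real algebras. Continuity of maps $Q\to M_n(F)$ is with respect to the norm, and $C(Q,M_n(F))$ has pointwise operations. A derivation on a (real) associative algebra $A$ is a (real-)linear map $D:A\to A$ with $D(xy)=D(x)y+xD(y)$ for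 all $x,y\in A$. A 2-local derivation on $A$ is a map $\bigtriangleup:A\to A$ (not linear in general) such that for every two elements $x,y\in A$ there exists a derivation $D_{x,y}:A\to A$ with $\bigtriangleup(x)=D_{x,y}(x)$ and $\bigtriangleup(y)=D_{x,y}(y)$. *)

theory Defs
  imports "HOL-Analysis.Analysis" "HOL-Algebra.Module"
begin

section \<open>Quaternions\<close>

datatype quat = Quat (QRe: real) (QI: real) (QJ: real) (QK: real)

lemma quat_eq_iff: "p = q \<longleftrightarrow> QRe p = QRe q \<and> QI p = QI q \<and> QJ p = QJ q \<and> QK p = QK q"
  by (cases p; cases q) auto

instantiation quat :: real_normed_div_algebra
begin

definition "0 = Quat 0 0 0 0"
definition "1 = Quat 1 0 0 0"
definition "- p = Quat (- QRe p) (- QI p) (- QJ p) (- QK p)"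
definition "p + q = Quat (QRe p + QRe q) (QI p + QI q) (QJ p + QJ q) (QK p + QK q)"
definition "p - q = Quat (QRe p - QRe q) (QI p - QI q) (QJ p - QJ q) (QK p - QK q)"
definition "r *\<^sub>R p = Quat (r * QRe p) (r * QI p) (r * QJ p) (r * QK p)"
definition
  "p * q = Quat
     (QRe p * QRe q - QI p * QI q - QJ p * QJ q - QK p * QK q)
     (QRe p * QI q + QI p * QRe q + QJ p * QK q - QK p * QJ q)
     (QRe p * QJ q - QI p * QK q + QJ p * QRe q + QK p * QI q)
     (QRe p * QK q + QI p * QJ q - QJ p * QI q + QK p * QRe q)"
definition "norm p = sqrt ((QRe p)\<^sup>2 + (QI p)\<^sup>2 + (QJ p)\<^sup>2 + (QK p)\<^sup>2)"
definition
  "inverse p = (let s = (QRe p)\<^sup>2 + (QI p)\<^sup>2 + (QJ p)\<^sup>2 + (QK p)\<^sup>2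
     in Quat (QRe p / s) (- QI p / s) (- QJ p / s) (- QK p / s))"
definition "p div (q::quat) = p * inverse q"
definition "sgn p = inverse (norm (p::quat)) *\<^sub>R p"
definition "dist p q = norm (p - q :: quat)"
definition [code del]: "uniformity = (INF e\<in>{0<..}. principal {(x, y). dist x (y::quat) < e})"
definition [code del]: "open (U :: quat set) \<longleftrightarrow>
   (\<forall>x\<in>U. eventually (\<lambda>(x', y). x' = x \<longrightarrow> y \<in> U) uniformity)"

lemmas quat_ops_defs = zero_quat_def one_quat_def uminus_quat_def plus_quat_def minus_quat_def
  scaleR_quat_def times_quat_def

lemma quat_sumsq_eq_0:
  "(QRe p)\<^sup>2 + (QI p)\<^sup>2 + (QJ p)\<^sup>2 + (QK p)\<^sup>2 = 0 \<longleftrightarrow> p = 0"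
proof -
  have "a\<^sup>2 + b\<^sup>2 + c\<^sup>2 + d\<^sup>2 = 0 \<longleftrightarrow> a = 0 \<and> b = 0 \<and> c = 0 \<and> d = 0" for a b c d :: real
    by (simp add: add_nonneg_eq_0_iff conj_assoc)
  then show ?thesis
    by (simp add: quat_eq_iff zero_quat_def)
qed

instance
proof
  fix p q r :: quat and a b :: real
  show "p + q + r = p + (q + r)" "p + q = q + p" "0 + p = p" "- p + p = 0" "p - q = p + - q"
    "a *\<^sub>R (p + q) = a *\<^sub>R p + a *\<^sub>R q" "(a + b) *\<^sub>R p = a *\<^sub>R p + b *\<^sub>R p"
    "a *\<^sub>R b *\<^sub>R p = (a * b) *\<^sub>R p" "1 *\<^sub>R p = p"
    "p * q * r = p * (q * r)" "1 * p = p" "p * 1 = p"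
    "(p + q) * r = p * r + q * r" "p * (q + r) = p * q + p * r"
    "(a *\<^sub>R p) * q = a *\<^sub>R (p * q)" "p * a *\<^sub>R q = a *\<^sub>R (p * q)" "(0::quat) \<noteq> 1"
    by (simp_all add: quat_ops_defs algebra_simps)
  show "p div q = p * inverse q" "sgn p = inverse (norm p) *\<^sub>R p" "dist p q = norm (p - q)"
    by (rule divide_quat_def sgn_quat_def dist_quat_def)+
  show "uniformity = (INF e\<in>{0<..}. principal {(x, y). dist x (y::quat) < e})"
    by (rule uniformity_quat_def)
  show "open U \<longleftrightarrow> (\<forall>x\<in>U. eventually (\<lambda>(x', y). x' = x \<longrightarrow> y \<in> U) uniformity)" for U :: "quat set"
    by (rule open_quat_def)
  show "inverse (0::quat) = 0"
    by (simp add: inverse_quat_def zero_quat_def)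
  {
    assume "p \<noteq> 0"
    define s where "s = (QRe p)\<^sup>2 + (QI p)\<^sup>2 + (QJ p)\<^sup>2 + (QK p)\<^sup>2"
    have "s \<noteq> 0"
      using \<open>p \<noteq> 0\<close> quat_sumsq_eq_0 s_def by metis
    moreover have "inverse p = Quat (QRe p / s) (- QI p / s) (- QJ p / s) (- QK p / s)"
      by (simp add: inverse_quat_def s_def Let_def)
    ultimately show "inverse p * p = 1" "p * inverse p = 1"
      by (simp_all add: times_quat_def one_quat_def field_simps)
         (simp_all add: s_def power2_eq_square)
  }
  show "norm p = 0 \<longleftrightarrow> p = 0"
    using quat_sumsq_eq_0[of p] by (simp add: norm_quat_def)
  show "norm (a *\<^sub>R p) = \<bar>a\<bar> * norm p"
  proof -
    have "(QRe (a *\<^sub>R p))\<^sup>2 + (QI (a *\<^sub>R p))\<^sup>2 + (QJ (a *\<^sub>R p))\<^sup>2 + (QK (a *\<^sub>R p))\<^sup>2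
        = a\<^sup>2 * ((QRe p)\<^sup>2 + (QI p)\<^sup>2 + (QJ p)\<^sup>2 + (QK p)\<^sup>2)"
      by (simp add: scaleR_quat_def power_mult_distrib algebra_simps)
    then show ?thesis
      by (simp add: norm_quat_def real_sqrt_mult)
  qed
  show "norm (p * q) = norm p * norm q"
    unfolding norm_quat_def real_sqrt_mult[symmetric]
    by (simp add: times_quat_def power2_eq_square algebra_simps)
  have *: "norm x = norm (Complex (QRe x) (QI x), Complex (QJ x) (QK x))" for x :: quat
    by (simp add: norm_quat_def norm_prod_def cmod_def add.assoc)
  show "norm (p + q) \<le> norm p + norm q"
    unfolding * using norm_triangle_ineq[of "(Complex (QRe p) (QI p), Complex (QJ p) (QK p))"
        "(Complex (QRe q) (QI q), Complex (QJ q) (QK q))"]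
    by (simp add: plus_quat_def plus_complex.code complex_eq_iff)
qed

end


section \<open>Infinite matrices with uniformly bounded finite submatrices\<close>

text \<open>
  Operator norm of the square submatrix \<open>(A i j)\<close> with \<open>i, j \<in> S\<close>, for finite \<open>S\<close>, acting from the
  left on column vectors with the Euclidean norm. Only the entries of \<open>x\<close> in \<open>S\<close> matter.
\<close>

definition submat_onorm :: "'i set \<Rightarrow> ('i \<Rightarrow> 'i \<Rightarrow> 'f::real_normed_div_algebra) \<Rightarrow> real" where
  "submat_onorm S A =
     (SUP x \<in> {x. L2_set (\<lambda>j. norm (x j)) S \<le> 1}. L2_set (\<lambda>i. norm (\<Sum>j\<in>S. A i j * x j)) S)"

definition bmat :: "('i \<Rightarrow> 'i \<Rightarrow> 'f::real_normed_div_algebra) set" where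
  "bmat = {A. \<exists>K. \<forall>S. finite S \<longrightarrow> submat_onorm S A \<le> K}"

definition bmat_norm :: "('i \<Rightarrow> 'i \<Rightarrow> 'f::real_normed_div_algebra) \<Rightarrow> real" where
  "bmat_norm A = (SUP S \<in> {S. finite S}. submat_onorm S A)"

text \<open>
  The locale \<open>Metric_space\<close> demands nonnegativity and symmetry of the distance also outside the
  carrier, where the supremum in \<open>bmat_norm\<close> is unspecified; hence the dummy value \<open>0\<close>.
\<close>

definition bmat_dist ::
  "('i \<Rightarrow> 'i \<Rightarrow> 'f::real_normed_div_algebra) \<Rightarrow> ('i \<Rightarrow> 'i \<Rightarrow> 'f) \<Rightarrow> real" where
  "bmat_dist A B = (if A \<in> bmat \<and> B \<in> bmat then bmat_norm (\<lambda>i j. A i j - B i j) else 0)"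

lemma submat_onorm_upper:
  fixes A :: "'i \<Rightarrow> 'i \<Rightarrow> 'f::real_normed_div_algebra"
  assumes "finite S" "L2_set (\<lambda>j. norm (x j)) S \<le> 1"
  shows "L2_set (\<lambda>i. norm (\<Sum>j\<in>S. A i j * x j)) S \<le> submat_onorm S A"
  unfolding submat_onorm_def
proof (rule cSUP_upper)
  show "bdd_above ((\<lambda>x. L2_set (\<lambda>i. norm (\<Sum>j\<in>S. A i j * x j)) S) `
      {x. L2_set (\<lambda>j. norm (x j)) S \<le> 1})"
  proof (rule bdd_aboveI2)
    fix y :: "'i \<Rightarrow> 'f" assume "y \<in> {x. L2_set (\<lambda>j. norm (x j)) S \<le> 1}"
    then have y: "norm (y j) \<le> 1" if "j \<in> S" for j
      using member_le_L2_set[OF assms(1) that, of "\<lambda>j. norm (y j)"] by simp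
    have "L2_set (\<lambda>i. norm (\<Sum>j\<in>S. A i j * y j)) S \<le> (\<Sum>i\<in>S. norm (\<Sum>j\<in>S. A i j * y j))"
      by (rule L2_set_le_sum) simp
    also have "\<dots> \<le> (\<Sum>i\<in>S. \<Sum>j\<in>S. norm (A i j))"
      by (intro sum_mono sum_norm_le) (simp add: norm_mult mult_left_le y)
    finally show "L2_set (\<lambda>i. norm (\<Sum>j\<in>S. A i j * y j)) S \<le> (\<Sum>i\<in>S. \<Sum>j\<in>S. norm (A i j))" .
  qed
qed (use assms in simp)

lemma submat_onorm_le:
  fixes A :: "'i \<Rightarrow> 'i \<Rightarrow> 'f::real_normed_div_algebra"
  assumes "\<And>x. L2_set (\<lambda>j. norm (x j)) S \<le> 1 \<Longrightarrow>
    L2_set (\<lambda>i. norm (\<Sum>j\<in>S. A i j * x j)) S \<le> K"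
  shows "submat_onorm S A \<le> K"
  unfolding submat_onorm_def
proof (rule cSUP_least)
  have "(\<lambda>_. 0) \<in> {x :: 'i \<Rightarrow> 'f. L2_set (\<lambda>j. norm (x j)) S \<le> 1}"
    by (simp add: L2_set_def)
  then show "{x :: 'i \<Rightarrow> 'f. L2_set (\<lambda>j. norm (x j)) S \<le> 1} \<noteq> {}"
    by (rule ex_in_conv[THEN iffD1, OF exI])
qed (use assms in simp)

lemma submat_onorm_nonneg: "finite S \<Longrightarrow> 0 \<le> submat_onorm S A"
  using submat_onorm_upper[of S "\<lambda>_. 0" A] by (simp add: L2_set_def)

lemma submat_onorm_minus_commute:
  "submat_onorm S (\<lambda>i j. A i j - B i j) = submat_onorm S (\<lambda>i j. B i j - A i j)"
proof -
  have "(\<Sum>j\<in>S. (A i j - B i j) * x j) = - (\<Sum>j\<in>S. (B i j - A i j) * x j)" for i x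
    unfolding sum_negf[symmetric] by (rule sum.cong) (simp_all add: left_diff_distrib)
  then show ?thesis
    unfolding submat_onorm_def by simp
qed

lemma submat_onorm_diff_triangle:
  fixes A :: "'i \<Rightarrow> 'i \<Rightarrow> 'f::real_normed_div_algebra"
  assumes "finite S"
  shows "submat_onorm S (\<lambda>i j. A i j - C i j)
    \<le> submat_onorm S (\<lambda>i j. A i j - B i j) + submat_onorm S (\<lambda>i j. B i j - C i j)"
proof (rule submat_onorm_le)
  fix x :: "'i \<Rightarrow> 'f" assume x: "L2_set (\<lambda>j. norm (x j)) S \<le> 1"
  let ?u = "\<lambda>i. \<Sum>j\<in>S. (A i j - B i j) * x j" and ?v = "\<lambda>i. \<Sum>j\<in>S. (B i j - C i j) * x j"
  have "(\<Sum>j\<in>S. (A i j - C i j) * x j) = ?u i + ?v i" for i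
    unfolding sum.distrib[symmetric] by (rule sum.cong) (simp_all add: left_diff_distrib)
  then have "L2_set (\<lambda>i. norm (\<Sum>j\<in>S. (A i j - C i j) * x j)) S
      \<le> L2_set (\<lambda>i. norm (?u i) + norm (?v i)) S"
    by (intro L2_set_mono) (auto intro: norm_triangle_ineq)
  also have "\<dots> \<le> L2_set (\<lambda>i. norm (?u i)) S + L2_set (\<lambda>i. norm (?v i)) S"
    by (rule L2_set_triangle_ineq)
  also have "\<dots> \<le> submat_onorm S (\<lambda>i j. A i j - B i j) + submat_onorm S (\<lambda>i j. B i j - C i j)"
    by (intro add_mono submat_onorm_upper assms x)
  finally show "L2_set (\<lambda>i. norm (\<Sum>j\<in>S. (A i j - C i j) * x j)) S
      \<le> submat_onorm S (\<lambda>i j. A i j - B i j) + submat_onorm S (\<lambda>i j. B i j - C i j)" .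
qed

lemma norm_entry_le_submat_onorm:
  fixes A :: "'i \<Rightarrow> 'i \<Rightarrow> 'f::real_normed_div_algebra"
  assumes "finite S" "i \<in> S" "j \<in> S"
  shows "norm (A i j) \<le> submat_onorm S A"
proof -
  let ?e = "\<lambda>k. if k = j then 1 else 0"
  have "L2_set (\<lambda>k. norm (?e k :: 'f)) S = sqrt (\<Sum>k\<in>S. if k = j then 1 else 0)"
    unfolding L2_set_def by (intro arg_cong[where f = sqrt] sum.cong) auto
  then have e: "L2_set (\<lambda>k. norm (?e k :: 'f)) S \<le> 1"
    using assms by simp
  have "norm (A i j) = norm (\<Sum>k\<in>S. A i k * ?e k)"
    using assms by (simp add: if_distrib cong: if_cong)
  also have "\<dots> \<le> L2_set (\<lambda>i. norm (\<Sum>k\<in>S. A i k * ?e k)) S"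
    using assms by (intro member_le_L2_set)
  also have "\<dots> \<le> submat_onorm S A"
    by (rule submat_onorm_upper[OF assms(1) e])
  finally show ?thesis .
qed

lemma submat_onorm_le_bmat_norm:
  "A \<in> bmat \<Longrightarrow> finite S \<Longrightarrow> submat_onorm S A \<le> bmat_norm A"
  unfolding bmat_norm_def bmat_def by (rule cSUP_upper) (auto simp: bdd_above_def)

lemma bmat_norm_le: "(\<And>S. finite S \<Longrightarrow> submat_onorm S A \<le> K) \<Longrightarrow> bmat_norm A \<le> K"
  unfolding bmat_norm_def by (rule cSUP_least) auto

lemma bmat_diff:
  fixes A B :: "'i \<Rightarrow> 'i \<Rightarrow> 'f::real_normed_div_algebra"
  assumes "A \<in> bmat" "B \<in> bmat"
  shows "(\<lambda>i j. A i j - B i j) \<in> bmat"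
proof -
  have "submat_onorm S (\<lambda>i j. A i j - B i j) \<le> bmat_norm A + bmat_norm B" if "finite S" for S
  proof -
    have "submat_onorm S (\<lambda>i j. A i j - B i j) \<le> submat_onorm S A + submat_onorm S B"
      using submat_onorm_diff_triangle[OF that, of A B "\<lambda>_ _. 0"]
        submat_onorm_minus_commute[of S "\<lambda>_ _. 0" B] by simp
    then show ?thesis
      using submat_onorm_le_bmat_norm[OF _ that] assms by (meson add_mono order_trans)
  qed
  then show ?thesis
    by (auto simp: bmat_def)
qed

lemma Metric_space_bmat:
  "Metric_space bmat
     (bmat_dist :: ('i \<Rightarrow> 'i \<Rightarrow> 'f::real_normed_div_algebra) \<Rightarrow> ('i \<Rightarrow> 'i \<Rightarrow> 'f) \<Rightarrow> real)"
proof
  fix A B C :: "'i \<Rightarrow> 'i \<Rightarrow> 'f"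
  show "0 \<le> bmat_dist A B"
    using submat_onorm_le_bmat_norm[OF bmat_diff[of A B], of "{}"]
      submat_onorm_nonneg[of "{}" "\<lambda>i j. A i j - B i j"]
    by (auto simp: bmat_dist_def)
  show "bmat_dist A B = bmat_dist B A"
    unfolding bmat_dist_def bmat_norm_def by (simp add: submat_onorm_minus_commute[of _ A B])
  assume A: "A \<in> bmat" and B: "B \<in> bmat"
  have "bmat_norm (\<lambda>i j. A i j - B i j) = 0 \<longleftrightarrow> A = B"
  proof
    assume *: "bmat_norm (\<lambda>i j. A i j - B i j) = 0"
    have "norm (A i j - B i j) \<le> 0" for i j
    proof -
      have "norm (A i j - B i j) \<le> submat_onorm {i, j} (\<lambda>i j. A i j - B i j)"
        by (rule norm_entry_le_submat_onorm[where A = "\<lambda>i j. A i j - B i j"]) simp_all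
      also have "\<dots> \<le> bmat_norm (\<lambda>i j. A i j - B i j)"
        by (rule submat_onorm_le_bmat_norm[OF bmat_diff[OF A B]]) simp
      finally show ?thesis
        by (simp only: *)
    qed
    then show "A = B"
      by (intro ext) simp
  next
    assume "A = B"
    have "submat_onorm S (\<lambda>i j. 0 :: 'f) = 0" if "finite S" for S :: "'i set"
      using submat_onorm_le[of S "\<lambda>i j. 0 :: 'f" 0] submat_onorm_nonneg[OF that, of "\<lambda>i j. 0 :: 'f"]
      by (simp add: L2_set_def)
    then have "bmat_norm (\<lambda>i j :: 'i. 0 :: 'f) = (SUP S \<in> {S :: 'i set. finite S}. 0)"
      unfolding bmat_norm_def by (intro SUP_cong) auto
    also have "\<dots> = 0"
      by (rule cSUP_const) auto
    finally show "bmat_norm (\<lambda>i j. A i j - B i j) = 0"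
      using \<open>A = B\<close> by simp
  qed
  then show "bmat_dist A B = 0 \<longleftrightarrow> A = B"
    by (simp add: bmat_dist_def A B)
  assume C: "C \<in> bmat"
  have "bmat_norm (\<lambda>i j. A i j - C i j)
      \<le> bmat_norm (\<lambda>i j. A i j - B i j) + bmat_norm (\<lambda>i j. B i j - C i j)"
  proof (rule bmat_norm_le)
    fix S :: "'i set" assume S: "finite S"
    show "submat_onorm S (\<lambda>i j. A i j - C i j)
        \<le> bmat_norm (\<lambda>i j. A i j - B i j) + bmat_norm (\<lambda>i j. B i j - C i j)"
      using submat_onorm_diff_triangle[OF S, of A C B]
        submat_onorm_le_bmat_norm[OF bmat_diff[OF A B] S]
        submat_onorm_le_bmat_norm[OF bmat_diff[OF B C] S] by linarith
  qed
  then show "bmat_dist A C \<le> bmat_dist A B + bmat_dist B C"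
    by (simp add: bmat_dist_def A B C)
qed

definition bmat_topology :: "('i \<Rightarrow> 'i \<Rightarrow> 'f::real_normed_div_algebra) topology" where
  "bmat_topology = Metric_space.mtopology bmat bmat_dist"

text \<open>
  Real algebras are represented by the record type of \<^theory>\<open>HOL-Algebra.Module\<close> with scalars in
  \<^typ>\<open>real\<close>. The locale \<open>algebra\<close> of that theory is not used: it requires commutativity.
\<close>

definition bmat_alg :: "(real, 'i \<Rightarrow> 'i \<Rightarrow> 'f::real_normed_div_algebra) module" where
  "bmat_alg =
     \<lparr>carrier = bmat,
      mult = (\<lambda>A B i j. \<Sum>\<^sub>\<infinity>k. A i k * B k j),
      one = (\<lambda>i j. if i = j then 1 else 0),
      zero = (\<lambda>i j. 0),
      add = (\<lambda>A B i j. A i j + B i j),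
      smult = (\<lambda>r A i j. r *\<^sub>R A i j)\<rparr>"

text \<open>
  Continuous functions on \<open>Q\<close> are represented by functions that are undefined outside \<open>topspace Q\<close>,
  so that equality in the carrier is equality on \<open>topspace Q\<close>.
\<close>

definition cont_alg :: "'q topology \<Rightarrow> 'm topology \<Rightarrow> (real, 'm) module \<Rightarrow> (real, 'q \<Rightarrow> 'm) module"
  where
  "cont_alg Q T M =
     \<lparr>carrier = {f \<in> extensional (topspace Q). continuous_map Q T f},
      mult = (\<lambda>f g. \<lambda>q\<in>topspace Q. f q \<otimes>\<^bsub>M\<^esub> g q),
      one = (\<lambda>q\<in>topspace Q. \<one>\<^bsub>M\<^esub>),
      zero = (\<lambda>q\<in>topspace Q. \<zero>\<^bsub>M\<^esub>),
      add = (\<lambda>f g. \<lambda>q\<in>topspace Q. f q \<oplus>\<^bsub>M\<^esub> g q),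
      smult = (\<lambda>r f. \<lambda>q\<in>topspace Q. r \<odot>\<^bsub>M\<^esub> f q)\<rparr>"

definition C_bmat :: "'q topology \<Rightarrow> (real, 'q \<Rightarrow> 'i \<Rightarrow> 'i \<Rightarrow> 'f::real_normed_div_algebra) module" where
  "C_bmat Q = cont_alg Q bmat_topology bmat_alg"


section \<open>Derivations and 2-local derivations of real algebras\<close>

definition derivation :: "(real, 'a) module \<Rightarrow> ('a \<Rightarrow> 'a) \<Rightarrow> bool" where
  "derivation A D \<longleftrightarrow>
     D \<in> carrier A \<rightarrow> carrier A \<and>
     (\<forall>x\<in>carrier A. \<forall>y\<in>carrier A. D (x \<oplus>\<^bsub>A\<^esub> y) = D x \<oplus>\<^bsub>A\<^esub> D y) \<and>
     (\<forall>r. \<forall>x\<in>carrier A. D (r \<odot>\<^bsub>A\<^esub> x) = r \<odot>\<^bsub>A\<^esub> D x) \<and>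
     (\<forall>x\<in>carrier A. \<forall>y\<in>carrier A.
        D (x \<otimes>\<^bsub>A\<^esub> y) = (D x \<otimes>\<^bsub>A\<^esub> y) \<oplus>\<^bsub>A\<^esub> (x \<otimes>\<^bsub>A\<^esub> D y))"

definition two_local_derivation :: "(real, 'a) module \<Rightarrow> ('a \<Rightarrow> 'a) \<Rightarrow> bool" where
  "two_local_derivation A \<Delta> \<longleftrightarrow>
     \<Delta> \<in> carrier A \<rightarrow> carrier A \<and>
     (\<forall>x\<in>carrier A. \<forall>y\<in>carrier A. \<exists>D. derivation A D \<and> \<Delta> x = D x \<and> \<Delta> y = D y)"

end

theory Submission
  imports Defs
begin

text \<open>
  \<^emph>\<open>Reduction to a single point of \<open>Q\<close>.\<close> A continuous family \<open>f\<close> with \<open>f q = 0\<close> is the product of the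
  families \<open>\<parallel>f\<parallel>\<^sup>1\<^sup>/\<^sup>2\<close> and \<open>f / \<parallel>f\<parallel>\<^sup>1\<^sup>/\<^sup>2\<close> (zero where \<open>f\<close> is), which both vanish at \<open>q\<close>; by the Leibniz rule
  every derivation \<open>D\<close> satisfies \<open>(D f) q = 0\<close>. So \<open>(D f) q\<close> depends on \<open>f q\<close> only, through a
  derivation of the matrix algebra (\<open>derivation_C_bmat_pointwise\<close>). Since this can be tested on two
  families at a time, a 2-local derivation is likewise given pointwise by 2-local derivations
  of the matrix algebra.

  \<^emph>\<open>Additivity on matrices.\<close> If \<open>D\<close> is a commutator with some matrix and \<open>y\<close> is a scalar multiple of
  a matrix unit, then \<open>trace (D x * y) = - trace (x * D y)\<close>, where over the quaternions the
  trace is followed by the real part. Only the two values \<open>D x\<close> and \<open>D y\<close> occur, so the identity holds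
  for a 2-local derivation \<open>\<Delta>\<close> as well. Its right-hand side is additive in \<open>x\<close>, and its left-hand sides
  for all \<open>y\<close> determine \<open>\<Delta> x\<close>; hence \<open>\<Delta>\<close> is additive. The lemma \<open>tr_derivation_entry\<close> is this
  identity, with the infinite trace of \<open>x * D y\<close> contracted to three matrix entries and derived from
  the Leibniz rule alone, so that derivations need not be represented as commutators.

  \<^emph>\<open>The Leibniz rule on matrices.\<close> Testing \<open>\<Delta>\<close> on the pair \<open>x\<close>, \<open>x * x\<close> gives
  \<open>\<Delta> (x * x) = \<Delta> x * x + x * \<Delta> x\<close>. An additive map with this property on a prime ring without
  2-torsion is a derivation, by a theorem of Herstein (\<open>jordan_derivation_prime_ring\<close>).

  For these arguments the bounded matrices are made into a type that is a normed algebra. The one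
  analytic difficulty is associativity of the product, as the double sums involved
  need not converge absolutely (\<open>bmat_bilinear_assoc\<close>).
\<close>

section \<open>Jordan derivations of prime rings\<close>

text \<open>
  Moving \<open>b\<close> past \<open>a\<close> inside \<open>a z b w a\<close> in two ways gives both signs of \<open>a z (a w b)\<close>, so this
  product vanishes for all \<open>z\<close> and \<open>w\<close>.
\<close>

lemma prime_ring_symmetric_annihilation:
  fixes a b :: "'a::ring"
  assumes two_torsion_free: "\<And>x::'a. x + x = 0 \<Longrightarrow> x = 0"
    and prime: "\<And>a b::'a. (\<And>x. a * x * b = 0) \<Longrightarrow> a = 0 \<or> b = 0"
    and sym: "\<And>z. a * z * b + b * z * a = 0"
  shows "a = 0 \<or> b = 0"
proof (rule ccontr)
  assume ab: "\<not> (a = 0 \<or> b = 0)"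
  have "a * z * (a * w * b) = 0" for z w
  proof -
    have swap: "b * u * a = - (a * u * b)" for u
      using sym[of u] by (simp add: eq_neg_iff_add_eq_0 add.commute)
    have swap': "a * u * b = - (b * u * a)" for u
      using sym[of u] by (simp add: eq_neg_iff_add_eq_0)
    have "a * z * (b * w * a) = a * z * - (a * w * b)"
      by (simp only: swap)
    moreover have "a * z * (b * w * a) = a * z * (a * w * b)"
    proof -
      have "a * z * (b * w * a) = (a * z * b) * (w * a)"
        by (simp add: mult.assoc)
      also have "\<dots> = - (b * (z * a * w) * a)"
        unfolding swap' by (simp add: mult.assoc)
      also have "\<dots> = a * z * (a * w * b)"
        by (simp only: swap) (simp add: mult.assoc)
      finally show ?thesis .
    qed
    ultimately show ?thesis
      by (metis two_torsion_free mult_minus_right right_minus_eq diff_minus_eq_add)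
  qed
  then have "a * w * b = 0" for w
    using prime[of a "a * w * b"] ab by blast
  then show False
    using prime[of a b] ab by blast
qed

text \<open>
  Herstein's theorem, with Bresar's proof. Let \<open>\<delta> x y\<close> be the defect in the Leibniz rule. Expanding \<open>d\<close> of
  \<open>x y z y x + y x z x y\<close> once around the outer factors and once as a sum of two triple products yields
  \<open>\<delta> x y z [x, y] + [x, y] z \<delta> x y = 0\<close>, so \<open>\<delta> x y = 0\<close> or \<open>[x, y] = 0\<close> for each pair. As a group
  is not the union of two proper subgroups, either \<open>\<delta> = 0\<close> or the ring is commutative, and in the
  latter case the linearized hypothesis is twice the Leibniz rule.
\<close>

theorem jordan_derivation_prime_ring:
  fixes d :: "'a::ring \<Rightarrow> 'a"
  assumes two_torsion_free: "\<And>x::'a. x + x = 0 \<Longrightarrow> x = 0"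
    and prime: "\<And>a b::'a. (\<And>x. a * x * b = 0) \<Longrightarrow> a = 0 \<or> b = 0"
    and add: "\<And>x y. d (x + y) = d x + d y"
    and square: "\<And>x. d (x * x) = d x * x + x * d x"
  shows "d (x * y) = d x * y + x * d y"
proof -
  have halve: "u = v" if "u + u = v + v" for u v :: 'a
  proof -
    have "(u - v) + (u - v) = 0"
      using that by (simp add: algebra_simps)
    from two_torsion_free[OF this] show ?thesis by simp
  qed
  have jordan: "d (x * y) + d (y * x) = d x * y + x * d y + d y * x + y * d x" for x y
    using square[of "x + y"] by (simp add: algebra_simps add square)
  have triple: "d (x * y * x) = d x * y * x + x * d y * x + x * y * d x" for x y
  proof (rule halve)
    have "d (x * y * x) + d (x * y * x) + d (x * (x * y)) + d (y * x * x)
        = d (x * (x * y + y * x)) + d ((x * y + y * x) * x)"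
      by (simp add: algebra_simps add)
    also have "\<dots> = d x * (x * y + y * x) + x * d (x * y + y * x)
        + d (x * y + y * x) * x + (x * y + y * x) * d x"
      by (rule jordan)
    also have "d (x * y + y * x) = d x * y + x * d y + d y * x + y * d x"
      by (simp only: add jordan)
    finally have "d (x * y * x) + d (x * y * x) = d x * (x * y + y * x)
        + x * (d x * y + x * d y + d y * x + y * d x) + (d x * y + x * d y + d y * x + y * d x) * x
        + (x * y + y * x) * d x - (d (x * x * y) + d (y * (x * x)))"
      by (simp add: algebra_simps)
    also have "d (x * x * y) + d (y * (x * x)) =
        d (x * x) * y + x * x * d y + d y * (x * x) + y * d (x * x)"
      by (rule jordan)
    finally show "d (x * y * x) + d (x * y * x) =
        d x * y * x + x * d y * x + x * y * d x + (d x * y * x + x * d y * x + x * y * d x)"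
      by (simp add: algebra_simps square)
  qed
  have triple': "d (x * z * y) + d (y * z * x) =
      d x * z * y + x * d z * y + x * z * d y + (d y * z * x + y * d z * x + y * z * d x)" for x y z
  proof -
    have "d (x * z * x) + (d (x * z * y) + d (y * z * x)) + d (y * z * y) = d ((x + y) * z * (x + y))"
      by (simp add: algebra_simps add)
    also have "\<dots> = (d x + d y) * z * (x + y) + (x + y) * d z * (x + y) + (x + y) * z * (d x + d y)"
      by (simp only: triple add)
    finally have "d (x * z * y) + d (y * z * x) =
        (d x + d y) * z * (x + y) + (x + y) * d z * (x + y) + (x + y) * z * (d x + d y)
        - d (x * z * x) - d (y * z * y)"
      by (simp add: algebra_simps)
    then show ?thesis
      by (simp only: triple) (simp add: algebra_simps)
  qed
  define \<delta> where "\<delta> x y = d (x * y) - d x * y - x * d y" for x y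
  have \<delta>_swap: "\<delta> y x = - \<delta> x y" for x y
    using jordan[of x y] by (simp add: \<delta>_def algebra_simps)
  have \<delta>_add: "\<delta> (x + x') y = \<delta> x y + \<delta> x' y" "\<delta> y (x + x') = \<delta> y x + \<delta> y x'" for x x' y
    by (simp_all add: \<delta>_def add algebra_simps)
  \<comment> \<open>Two expansions of \<open>d (x y z y x + y x z x y)\<close>: \<open>triple'\<close> with outer factors \<open>x y\<close> and
    \<open>y x\<close>, against \<open>triple\<close> applied twice to each summand.\<close>
  have "\<delta> x y * z * (x * y - y * x) + (x * y - y * x) * z * \<delta> x y = 0" for x y z
  proof -
    have "d (x * y * z * (y * x)) + d (y * x * z * (x * y)) =
        d (x * (y * z * y) * x) + d (y * (x * z * x) * y)"
      by (simp add: mult.assoc)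
    then have "d (x * y) * z * (y * x) + x * y * z * d (y * x)
        + (d (y * x) * z * (x * y) + y * x * z * d (x * y)) =
        (d x * y + x * d y) * z * (y * x) + x * y * z * (d y * x + y * d x)
        + ((d y * x + y * d x) * z * (x * y) + y * x * z * (d x * y + x * d y))"
      by (simp add: triple' triple) (simp add: algebra_simps)
    then have "\<delta> x y * z * (y * x) + x * y * z * \<delta> y x
        + (\<delta> y x * z * (x * y) + y * x * z * \<delta> x y) = 0"
      by (simp add: \<delta>_def algebra_simps)
    then show ?thesis
      by (simp add: \<delta>_swap[of y x] algebra_simps)
  qed
  then have dichotomy: "\<delta> x y = 0 \<or> x * y = y * x" for x y
    using prime_ring_symmetric_annihilation[OF two_torsion_free prime, of "\<delta> x y" "x * y - y * x"]
    by simp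
  have "\<delta> x y = 0"
  proof (rule ccontr)
    assume xy: "\<delta> x y \<noteq> 0"
    \<comment> \<open>The dichotomy for fixed \<open>u\<close>: the two additive groups \<open>{v. \<delta> u v = 0}\<close> and the
      centralizer of \<open>u\<close> cover the ring, and the first one is proper.\<close>
    have left: "u * v = v * u" if "\<delta> u w \<noteq> 0" for u v w
    proof (cases "\<delta> u v = 0")
      case True
      then have "\<delta> u (w + v) \<noteq> 0"
        using that by (simp add: \<delta>_add)
      then have "u * (w + v) = (w + v) * u" "u * w = w * u"
        using dichotomy that by blast+
      then show ?thesis
        by (simp add: distrib_left distrib_right)
    qed (use dichotomy in blast)
    \<comment> \<open>The same argument in the first variable: \<open>{u. \<delta> u y = 0}\<close> is proper, since it does not contain
      \<open>x\<close>, so every \<open>u\<close> is central.\<close>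
    have comm: "u * v = v * u" for u v :: 'a
    proof (cases "\<delta> u y = 0")
      case True
      then have "\<delta> (x + u) y \<noteq> 0"
        using xy by (simp add: \<delta>_add)
      then have "(x + u) * v = v * (x + u)" "x * v = v * x"
        using left xy by blast+
      then show ?thesis
        by (simp add: distrib_left distrib_right)
    qed (use left in blast)
    have "d (x * y) = d x * y + x * d y"
    proof (rule halve)
      show "d (x * y) + d (x * y) = d x * y + x * d y + (d x * y + x * d y)"
        using jordan[of x y] comm[of y x] comm[of "d y" x] comm[of y "d x"] by (simp add: add_ac)
    qed
    then show False
      using xy by (simp add: \<delta>_def)
  qed
  then show ?thesis
    by (simp add: \<delta>_def algebra_simps)
qed

section \<open>Bounded matrices acting on square-summable vectors\<close>

text \<open>
  Vectors of \<open>l\<^sub>2\<close> of norm at most \<open>K\<close>, described by finite sections just as the matrices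
  in \<open>bmat\<close> are, so that operator bounds pass from finite submatrices to vectors of infinite support.
\<close>

definition l2_bounded :: "real \<Rightarrow> ('i \<Rightarrow> 'f::real_normed_vector) \<Rightarrow> bool" where
  "l2_bounded K v \<longleftrightarrow> (\<forall>T. finite T \<longrightarrow> L2_set (\<lambda>k. norm (v k)) T \<le> K)"

lemma l2_boundedD: "l2_bounded K v \<Longrightarrow> finite T \<Longrightarrow> L2_set (\<lambda>k. norm (v k)) T \<le> K"
  by (simp add: l2_bounded_def)

lemma l2_bounded_nonneg: "l2_bounded K v \<Longrightarrow> 0 \<le> K"
  using l2_boundedD[of K v "{}"] by simp

lemma l2_bounded_finite_support:
  assumes "finite S" "\<And>k. k \<notin> S \<Longrightarrow> v k = 0"
  shows "l2_bounded (L2_set (\<lambda>k. norm (v k)) S) v"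
  unfolding l2_bounded_def L2_set_def
proof (intro allI impI real_sqrt_le_mono)
  fix T :: "'a set" assume "finite T"
  then have "(\<Sum>k\<in>T. (norm (v k))\<^sup>2) = (\<Sum>k\<in>T \<inter> S. (norm (v k))\<^sup>2)"
    using assms by (intro sum.mono_neutral_right) auto
  also have "\<dots> \<le> (\<Sum>k\<in>S. (norm (v k))\<^sup>2)"
    using assms by (intro sum_mono2) auto
  finally show "(\<Sum>k\<in>T. (norm (v k))\<^sup>2) \<le> (\<Sum>k\<in>S. (norm (v k))\<^sup>2)" .
qed

lemma l2_bounded_sum_norm_mult_le:
  fixes u v :: "'i \<Rightarrow> 'f::real_normed_div_algebra"
  assumes "l2_bounded K u" "l2_bounded L v" "finite T"
  shows "(\<Sum>k\<in>T. norm (u k * v k)) \<le> K * L"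
proof -
  have "(\<Sum>k\<in>T. norm (u k * v k)) \<le> L2_set (\<lambda>k. norm (u k)) T * L2_set (\<lambda>k. norm (v k)) T"
    using L2_set_mult_ineq[of "\<lambda>k. norm (u k)" "\<lambda>k. norm (v k)" T] by (simp add: norm_mult)
  also have "\<dots> \<le> K * L"
    by (intro mult_mono l2_boundedD[OF _ assms(3)] assms l2_bounded_nonneg[OF assms(1)]) simp
  finally show ?thesis .
qed

lemma infsum_finite_sum:
  fixes f :: "'j \<Rightarrow> 'k \<Rightarrow> 'f::{topological_comm_monoid_add, t2_space}"
  assumes "\<And>j. j \<in> S \<Longrightarrow> f j summable_on A"
  shows "(\<Sum>\<^sub>\<infinity>k\<in>A. \<Sum>j\<in>S. f j k) = (\<Sum>j\<in>S. \<Sum>\<^sub>\<infinity>k\<in>A. f j k)"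
proof -
  have "(\<lambda>k. \<Sum>j\<in>S. f j k) summable_on A \<and>
      (\<Sum>\<^sub>\<infinity>k\<in>A. \<Sum>j\<in>S. f j k) = (\<Sum>j\<in>S. \<Sum>\<^sub>\<infinity>k\<in>A. f j k)"
    using assms
    by (induction S rule: infinite_finite_induct) (simp_all add: infsum_add summable_on_add)
  then show ?thesis ..
qed

lemma l2_bounded_abs_summable_mult:
  fixes u v :: "'i \<Rightarrow> 'f::real_normed_div_algebra"
  assumes "l2_bounded K u" "l2_bounded L v"
  shows "(\<lambda>k. norm (u k * v k)) summable_on UNIV"
  by (rule nonneg_bdd_above_summable_on)
     (auto intro!: bdd_aboveI2[of _ _ "K * L"] l2_bounded_sum_norm_mult_le[OF assms])

lemma l2_bounded_summable_mult:
  fixes u v :: "'i \<Rightarrow> 'f::{real_normed_div_algebra, banach}"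
  assumes "l2_bounded K u" "l2_bounded L v"
  shows "(\<lambda>k. u k * v k) summable_on UNIV"
  by (rule abs_summable_summable) (rule l2_bounded_abs_summable_mult[OF assms])

lemma l2_bounded_norm_infsum_mult_le:
  fixes u v :: "'i \<Rightarrow> 'f::{real_normed_div_algebra, banach}"
  assumes "l2_bounded K u" "l2_bounded L v"
  shows "norm (\<Sum>\<^sub>\<infinity>k. u k * v k) \<le> K * L"
proof -
  have "norm (\<Sum>\<^sub>\<infinity>k. u k * v k) \<le> (\<Sum>\<^sub>\<infinity>k. norm (u k * v k))"
    by (rule norm_infsum_bound) (rule l2_bounded_abs_summable_mult[OF assms])
  also have "\<dots> \<le> K * L"
    by (rule infsum_le_finite_sums)
       (auto intro: l2_bounded_abs_summable_mult[OF assms] l2_bounded_sum_norm_mult_le[OF assms])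
  finally show ?thesis .
qed

text \<open>
  The vectors supported in finite sets are dense in \<open>l\<^sub>2\<close>: beyond a set \<open>T\<close> on which the sum of squares
  comes within \<open>e\<^sup>2\<close> of its supremum, the remaining sum of squares is at most \<open>e\<^sup>2\<close>.
\<close>

lemma l2_bounded_small_tail:
  fixes v :: "'i \<Rightarrow> 'f::real_normed_vector"
  assumes v: "l2_bounded K v" and "0 < e"
  shows "\<exists>T. finite T \<and> (\<forall>S. T \<subseteq> S \<longrightarrow> l2_bounded e (\<lambda>k. if k \<in> S then 0 else v k))"
proof -
  define q where "q T = (\<Sum>k\<in>T. (norm (v k))\<^sup>2)" for T
  have q_le: "q T \<le> K\<^sup>2" if "finite T" for T
    using l2_boundedD[OF v that] by (auto simp: q_def L2_set_def sum_nonneg intro: sqrt_le_D)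
  define s where "s = (SUP T\<in>{T. finite T}. q T)"
  have bdd: "bdd_above (q ` {T. finite T})"
    using q_le by (auto intro!: bdd_aboveI2)
  then have q_le_s: "q T \<le> s" if "finite T" for T
    unfolding s_def using that by (intro cSUP_upper) auto
  have "s - e\<^sup>2 < s"
    using \<open>0 < e\<close> by simp
  then obtain T where T: "finite T" "s - e\<^sup>2 < q T"
    unfolding s_def by (subst (asm) less_cSUP_iff) (use bdd in auto)
  have "l2_bounded e (\<lambda>k. if k \<in> S then 0 else v k)" if "T \<subseteq> S" for S
    unfolding l2_bounded_def
  proof (intro allI impI)
    fix R :: "'i set" assume "finite R"
    have "L2_set (\<lambda>k. norm (if k \<in> S then 0 else v k)) R = sqrt (q (R - S))"
      unfolding L2_set_def q_def using \<open>finite R\<close>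
      by (intro arg_cong[where f = sqrt] sum.mono_neutral_cong_right) auto
    also have "q (R - S) \<le> e\<^sup>2"
    proof -
      have "q (R - S) + q T = q ((R - S) \<union> T)"
        unfolding q_def using \<open>finite R\<close> T \<open>T \<subseteq> S\<close> by (intro sum.union_disjoint[symmetric]) auto
      also have "\<dots> \<le> s"
        using \<open>finite R\<close> T by (intro q_le_s) auto
      finally show ?thesis
        using T by linarith
    qed
    then have "sqrt (q (R - S)) \<le> e"
      using \<open>0 < e\<close> by (intro real_le_lsqrt) (auto simp: q_def sum_nonneg)
    finally show "L2_set (\<lambda>k. norm (if k \<in> S then 0 else v k)) R \<le> e" .
  qed
  then show ?thesis
    using T by blast
qed

lemma bmat_norm_nonneg: "A \<in> bmat \<Longrightarrow> 0 \<le> bmat_norm A"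
  using submat_onorm_le_bmat_norm[of A "{}"] submat_onorm_nonneg[of "{}" A] by simp

lemma bmat_bound:
  fixes A :: "'i \<Rightarrow> 'i \<Rightarrow> 'f::real_normed_div_algebra"
  assumes "\<And>S x. finite S \<Longrightarrow> L2_set (\<lambda>j. norm (x j)) S \<le> 1 \<Longrightarrow>
    L2_set (\<lambda>i. norm (\<Sum>j\<in>S. A i j * x j)) S \<le> K"
  shows "A \<in> bmat" "bmat_norm A \<le> K"
  using assms by (auto simp: bmat_def intro!: exI[of _ K] submat_onorm_le bmat_norm_le)

text \<open>
  Row and column index sets may differ: an \<open>S \<times> T\<close> submatrix is part of the square one
  over \<open>S \<union> T\<close>, applied to vectors that vanish outside \<open>T\<close>.
\<close>

lemma bmat_rectangle_bound:
  fixes A :: "'i \<Rightarrow> 'i \<Rightarrow> 'f::real_normed_div_algebra"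
  assumes A: "A \<in> bmat" and S: "finite S" and T: "finite T"
  shows "L2_set (\<lambda>i. norm (\<Sum>j\<in>T. A i j * x j)) S \<le> bmat_norm A * L2_set (\<lambda>j. norm (x j)) T"
proof (cases "L2_set (\<lambda>j. norm (x j)) T = 0")
  case True
  then show ?thesis
    using T by (simp add: L2_set_eq_0_iff) (simp add: L2_set_0' bmat_norm_nonneg[OF A])
next
  case False
  define c where "c = L2_set (\<lambda>j. norm (x j)) T"
  have c: "0 < c"
    using False by (simp add: c_def less_le)
  define y where "y j = (if j \<in> T then x j /\<^sub>R c else 0)" for j
  let ?U = "S \<union> T"
  have sums: "(\<Sum>j\<in>?U. A i j * y j) = (\<Sum>j\<in>T. A i j * x j) /\<^sub>R c" for i
    using S T unfolding scaleR_sum_right by (intro sum.mono_neutral_cong_right) (auto simp: y_def)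
  have "L2_set (\<lambda>j. norm (y j)) ?U = L2_set (\<lambda>j. norm (y j)) T"
    unfolding L2_set_def using S T
    by (intro arg_cong[where f = sqrt] sum.mono_neutral_right) (auto simp: y_def)
  also have "\<dots> = L2_set (\<lambda>j. inverse c * norm (x j)) T"
    using c by (intro L2_set_cong) (auto simp: y_def)
  also have "\<dots> = 1"
    using c False by (simp add: L2_set_right_distrib[symmetric] c_def)
  finally have "L2_set (\<lambda>i. norm (\<Sum>j\<in>?U. A i j * y j)) ?U \<le> submat_onorm ?U A"
    using S T by (intro submat_onorm_upper) auto
  also have "\<dots> \<le> bmat_norm A"
    using S T by (intro submat_onorm_le_bmat_norm A) auto
  finally have *: "L2_set (\<lambda>i. norm (\<Sum>j\<in>?U. A i j * y j)) ?U \<le> bmat_norm A" .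
  have "inverse c * L2_set (\<lambda>i. norm (\<Sum>j\<in>T. A i j * x j)) S
      = L2_set (\<lambda>i. norm (\<Sum>j\<in>?U. A i j * y j)) S"
    using c by (simp add: sums L2_set_right_distrib)
  also have "\<dots> \<le> L2_set (\<lambda>i. norm (\<Sum>j\<in>?U. A i j * y j)) ?U"
    unfolding L2_set_def using S T by (intro real_sqrt_le_mono sum_mono2) auto
  finally have "inverse c * L2_set (\<lambda>i. norm (\<Sum>j\<in>T. A i j * x j)) S \<le> bmat_norm A"
    using * by linarith
  then show ?thesis
    using c by (simp add: field_simps flip: c_def)
qed

lemma bmat_column_l2_bounded:
  fixes A :: "'i \<Rightarrow> 'i \<Rightarrow> 'f::real_normed_div_algebra"
  assumes "A \<in> bmat"
  shows "l2_bounded (bmat_norm A) (\<lambda>i. A i j)"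
  unfolding l2_bounded_def
proof (intro allI impI)
  fix S :: "'i set" assume "finite S"
  then show "L2_set (\<lambda>i. norm (A i j)) S \<le> bmat_norm A"
    using bmat_rectangle_bound[OF assms, of S "{j}" "\<lambda>_. 1"] by simp
qed

lemma bmat_row_l2_bounded:
  fixes A :: "'i \<Rightarrow> 'i \<Rightarrow> 'f::real_normed_div_algebra"
  assumes "A \<in> bmat"
  shows "l2_bounded (bmat_norm A) (\<lambda>j. A i j)"
  unfolding l2_bounded_def
proof (intro allI impI)
  fix T :: "'i set" assume T: "finite T"
  define c where "c = L2_set (\<lambda>j. norm (A i j)) T"
  \<comment> \<open>This vector plays the role of the conjugate of the row: \<open>A i j * x j\<close> is \<open>(norm (A i j))\<^sup>2\<close>
    and \<open>x j\<close> has the same norm as \<open>A i j\<close>.\<close>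
  define x where "x j = (norm (A i j))\<^sup>2 *\<^sub>R inverse (A i j)" for j
  have "A i j * x j = of_real ((norm (A i j))\<^sup>2)" for j
    by (cases "A i j = 0") (auto simp: x_def of_real_def)
  then have "(\<Sum>j\<in>T. A i j * x j) = of_real (c\<^sup>2)"
    by (simp add: c_def L2_set_def sum_nonneg)
  moreover have "norm (x j) = norm (A i j)" for j
    by (cases "A i j = 0") (simp_all add: x_def norm_inverse power2_eq_square)
  ultimately have "c * c \<le> bmat_norm A * c"
    using bmat_rectangle_bound[OF assms _ T, of "{i}" x] by (simp add: c_def power2_eq_square norm_mult)
  moreover have "0 \<le> c"
    by (simp add: c_def)
  ultimately have "c \<le> bmat_norm A"
    using bmat_norm_nonneg[OF assms] by (cases "c = 0") (auto dest: mult_right_le_imp_le)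
  then show "L2_set (\<lambda>j. norm (A i j)) T \<le> bmat_norm A"
    by (simp add: c_def)
qed

lemma bmat_apply_l2_bounded:
  fixes A :: "'i \<Rightarrow> 'i \<Rightarrow> 'f::{real_normed_div_algebra, banach}"
  assumes A: "A \<in> bmat" and v: "l2_bounded K v"
  shows "l2_bounded (bmat_norm A * K) (\<lambda>i. \<Sum>\<^sub>\<infinity>k. A i k * v k)"
  unfolding l2_bounded_def
proof (intro allI impI)
  fix S :: "'i set" assume S: "finite S"
  let ?F = "finite_subsets_at_top (UNIV :: 'i set)"
  have "((\<lambda>T. \<Sum>k\<in>T. A i k * v k) \<longlongrightarrow> (\<Sum>\<^sub>\<infinity>k. A i k * v k)) ?F" for i
    by (intro infsum_tendsto l2_bounded_summable_mult[OF bmat_row_l2_bounded[OF A] v])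
  then have "((\<lambda>T. L2_set (\<lambda>i. norm (\<Sum>k\<in>T. A i k * v k)) S)
      \<longlongrightarrow> L2_set (\<lambda>i. norm (\<Sum>\<^sub>\<infinity>k. A i k * v k)) S) ?F"
    unfolding L2_set_def by (intro tendsto_intros)
  moreover have "L2_set (\<lambda>i. norm (\<Sum>k\<in>T. A i k * v k)) S \<le> bmat_norm A * K" if "finite T" for T
    using bmat_rectangle_bound[OF A S that, of v] l2_boundedD[OF v that] bmat_norm_nonneg[OF A]
    by (meson mult_left_mono order_trans)
  then have "\<forall>\<^sub>F T in ?F. L2_set (\<lambda>i. norm (\<Sum>k\<in>T. A i k * v k)) S \<le> bmat_norm A * K"
    by (intro eventually_finite_subsets_at_top_weakI) auto
  ultimately show "L2_set (\<lambda>i. norm (\<Sum>\<^sub>\<infinity>k. A i k * v k)) S \<le> bmat_norm A * K"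
    by (rule tendsto_upperbound) simp
qed

lemma
  fixes A B :: "'i \<Rightarrow> 'i \<Rightarrow> 'f::{real_normed_div_algebra, banach}"
  assumes A: "A \<in> bmat" and B: "B \<in> bmat"
  shows bmat_times: "(\<lambda>i j. \<Sum>\<^sub>\<infinity>k. A i k * B k j) \<in> bmat"
    and bmat_norm_times_le: "bmat_norm (\<lambda>i j. \<Sum>\<^sub>\<infinity>k. A i k * B k j) \<le> bmat_norm A * bmat_norm B"
proof -
  have "L2_set (\<lambda>i. norm (\<Sum>j\<in>S. (\<Sum>\<^sub>\<infinity>k. A i k * B k j) * x j)) S \<le> bmat_norm A * bmat_norm B"
    if S: "finite S" and x: "L2_set (\<lambda>j. norm (x j)) S \<le> 1" for S x
  proof -
    define v where "v k = (\<Sum>j\<in>S. B k j * x j)" for k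
    have "l2_bounded (bmat_norm B) v"
      unfolding l2_bounded_def v_def
      using bmat_rectangle_bound[OF B _ S, of _ x] x bmat_norm_nonneg[OF B]
      by (meson mult_left_le order_trans)
    from l2_boundedD[OF bmat_apply_l2_bounded[OF A this] S]
    have "L2_set (\<lambda>i. norm (\<Sum>\<^sub>\<infinity>k. A i k * v k)) S \<le> bmat_norm A * bmat_norm B" .
    moreover have "(\<Sum>\<^sub>\<infinity>k. A i k * v k) = (\<Sum>j\<in>S. (\<Sum>\<^sub>\<infinity>k. A i k * B k j) * x j)" for i
    proof -
      have sm: "(\<lambda>k. A i k * B k j) summable_on UNIV" for j
        by (rule l2_bounded_summable_mult[OF bmat_row_l2_bounded[OF A] bmat_column_l2_bounded[OF B]])
      have "(\<Sum>\<^sub>\<infinity>k. A i k * v k) = (\<Sum>\<^sub>\<infinity>k. \<Sum>j\<in>S. A i k * B k j * x j)"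
        by (simp add: v_def sum_distrib_left mult.assoc)
      also have "\<dots> = (\<Sum>j\<in>S. \<Sum>\<^sub>\<infinity>k. A i k * B k j * x j)"
        by (intro infsum_finite_sum summable_on_cmult_left sm)
      finally show ?thesis
        by (simp add: infsum_cmult_left')
    qed
    ultimately show ?thesis
      by simp
  qed
  from bmat_bound[OF this]
  show "(\<lambda>i j. \<Sum>\<^sub>\<infinity>k. A i k * B k j) \<in> bmat"
    "bmat_norm (\<lambda>i j. \<Sum>\<^sub>\<infinity>k. A i k * B k j) \<le> bmat_norm A * bmat_norm B"
    by auto
qed

text \<open>
  Both sides are linear in \<open>v\<close> and agree for \<open>v\<close> of finite support. The right-hand side is continuous
  in \<open>v\<close> with respect to the \<open>l\<^sub>2\<close> norm, so its values at the restrictions of \<open>v\<close> to finite sets, which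
  are the partial sums of the left-hand side, converge to its value at \<open>v\<close>. The double series
  need not converge absolutely, so the sums cannot simply be interchanged.
\<close>

lemma bmat_bilinear_assoc:
  fixes A :: "'i \<Rightarrow> 'i \<Rightarrow> 'f::{real_normed_div_algebra, banach}"
  assumes A: "A \<in> bmat" and u: "l2_bounded K u" and v: "l2_bounded L v"
  shows "(\<Sum>\<^sub>\<infinity>l. (\<Sum>\<^sub>\<infinity>k. u k * A k l) * v l) = (\<Sum>\<^sub>\<infinity>k. u k * (\<Sum>\<^sub>\<infinity>l. A k l * v l))"
proof (rule infsumI)
  define \<phi> where "\<phi> w = (\<Sum>\<^sub>\<infinity>k. u k * (\<Sum>\<^sub>\<infinity>l. A k l * w l))" for w
  note row = bmat_row_l2_bounded[OF A] and col = bmat_column_l2_bounded[OF A]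
  have bound: "norm (\<phi> w) \<le> K * (bmat_norm A * M)" if "l2_bounded M w" for w M
    unfolding \<phi>_def by (rule l2_bounded_norm_infsum_mult_le[OF u bmat_apply_l2_bounded[OF A that]])
  have split: "\<phi> v - (\<Sum>l\<in>T. (\<Sum>\<^sub>\<infinity>k. u k * A k l) * v l) = \<phi> (\<lambda>k. if k \<in> T then 0 else v k)"
    if T: "finite T" for T
  proof -
    define v\<^sub>1 where "v\<^sub>1 k = (if k \<in> T then v k else 0)" for k
    define v\<^sub>2 where "v\<^sub>2 k = (if k \<in> T then 0 else v k)" for k
    have v1: "l2_bounded (L2_set (\<lambda>k. norm (v\<^sub>1 k)) T) v\<^sub>1"
      by (rule l2_bounded_finite_support[OF T]) (simp add: v\<^sub>1_def)
    have "L2_set (\<lambda>k. norm (v\<^sub>2 k)) S \<le> L" if "finite S" for S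
      using l2_boundedD[OF v that]
      by (rule order_trans[rotated]) (auto intro!: L2_set_mono simp: v\<^sub>2_def)
    then have v2: "l2_bounded L v\<^sub>2"
      by (simp add: l2_bounded_def)
    have "(\<Sum>\<^sub>\<infinity>l. A k l * v l) = (\<Sum>\<^sub>\<infinity>l. A k l * v\<^sub>1 l) + (\<Sum>\<^sub>\<infinity>l. A k l * v\<^sub>2 l)" for k
      unfolding infsum_add[OF l2_bounded_summable_mult[OF row v1] l2_bounded_summable_mult[OF row v2],
          symmetric]
      by (intro infsum_cong) (simp add: v\<^sub>1_def v\<^sub>2_def)
    then have "\<phi> v = \<phi> v\<^sub>1 + \<phi> v\<^sub>2"
      unfolding \<phi>_def
      by (subst infsum_add[symmetric])
         (auto intro!: l2_bounded_summable_mult[OF u] bmat_apply_l2_bounded[OF A] v1 v2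
           simp: distrib_left)
    also have "\<phi> v\<^sub>1 = (\<Sum>\<^sub>\<infinity>k. \<Sum>l\<in>T. u k * A k l * v l)"
      unfolding \<phi>_def
    proof (rule infsum_cong)
      fix k
      have "(\<Sum>\<^sub>\<infinity>l. A k l * v\<^sub>1 l) = (\<Sum>\<^sub>\<infinity>l\<in>T. A k l * v l)"
        by (rule infsum_cong_neutral) (auto simp: v\<^sub>1_def)
      then show "u k * (\<Sum>\<^sub>\<infinity>l. A k l * v\<^sub>1 l) = (\<Sum>l\<in>T. u k * A k l * v l)"
        using T by (simp add: sum_distrib_left mult.assoc)
    qed
    also have "\<dots> = (\<Sum>l\<in>T. \<Sum>\<^sub>\<infinity>k. u k * A k l * v l)"
      by (intro infsum_finite_sum summable_on_cmult_left l2_bounded_summable_mult[OF u col])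
    finally show ?thesis
      by (simp add: infsum_cmult_left' v\<^sub>2_def [abs_def])
  qed
  have "((\<lambda>T. \<Sum>l\<in>T. (\<Sum>\<^sub>\<infinity>k. u k * A k l) * v l) \<longlongrightarrow> \<phi> v) (finite_subsets_at_top UNIV)"
  proof (rule tendstoI)
    fix e :: real assume e: "0 < e"
    define C where "C = K * bmat_norm A"
    have C: "0 \<le> C"
      using l2_bounded_nonneg[OF u] bmat_norm_nonneg[OF A] by (simp add: C_def)
    obtain T where T: "finite T"
      "\<And>S. T \<subseteq> S \<Longrightarrow> l2_bounded (e / (C + 1)) (\<lambda>k. if k \<in> S then 0 else v k)"
      using l2_bounded_small_tail[OF v, of "e / (C + 1)"] e C by auto
    show "\<forall>\<^sub>F T in finite_subsets_at_top UNIV.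
        dist (\<Sum>l\<in>T. (\<Sum>\<^sub>\<infinity>k. u k * A k l) * v l) (\<phi> v) < e"
      unfolding eventually_finite_subsets_at_top
    proof (intro exI[of _ T] conjI allI impI)
      fix S assume S: "finite S \<and> T \<subseteq> S \<and> S \<subseteq> UNIV"
      have "dist (\<Sum>l\<in>S. (\<Sum>\<^sub>\<infinity>k. u k * A k l) * v l) (\<phi> v)
          = norm (\<phi> v - (\<Sum>l\<in>S. (\<Sum>\<^sub>\<infinity>k. u k * A k l) * v l))"
        by (simp add: dist_norm norm_minus_commute)
      also have "\<dots> \<le> K * (bmat_norm A * (e / (C + 1)))"
        using S by (simp only: split) (intro bound T, simp)
      also have "\<dots> = C * e / (C + 1)"
        by (simp add: C_def)
      also have "\<dots> < e"
        using e C by (simp add: field_simps)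
      finally show "dist (\<Sum>l\<in>S. (\<Sum>\<^sub>\<infinity>k. u k * A k l) * v l) (\<phi> v) < e" .
    qed (use T in auto)
  qed
  then show "((\<lambda>l. (\<Sum>\<^sub>\<infinity>k. u k * A k l) * v l) has_sum
      (\<Sum>\<^sub>\<infinity>k. u k * (\<Sum>\<^sub>\<infinity>l. A k l * v l))) UNIV"
    by (simp add: has_sum_def \<phi>_def)
qed

section \<open>The normed algebra of bounded matrices\<close>

lemma bmat_zero: "(\<lambda>_ _. 0) \<in> bmat"
  by (rule bmat_bound[where K = 0]) (simp add: L2_set_def)

text \<open>
  As a type, the bounded matrices become an instance of the class of normed algebras, with its algebraic
  and limit rules. Completeness of \<open>'f\<close> makes the sums in the matrix product converge.
\<close>

typedef (overloaded) ('i, 'f) bop =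
  "bmat :: ('i \<Rightarrow> 'i \<Rightarrow> 'f::{real_normed_div_algebra, banach}) set"
  morphisms entry Bop
  using bmat_zero by blast

setup_lifting type_definition_bop

lemma bmat_uminus: "A \<in> bmat \<Longrightarrow> (\<lambda>i j. - A i j) \<in> bmat"
  using bmat_diff[OF bmat_zero] by fastforce

lemma bmat_add: "A \<in> bmat \<Longrightarrow> B \<in> bmat \<Longrightarrow> (\<lambda>i j. A i j + B i j) \<in> bmat"
  using bmat_diff[OF _ bmat_uminus[of B], of A] by simp

lemma
  fixes A :: "'i \<Rightarrow> 'i \<Rightarrow> 'f::real_normed_div_algebra"
  assumes A: "A \<in> bmat"
  shows bmat_scaleR: "(\<lambda>i j. r *\<^sub>R A i j) \<in> bmat"
    and bmat_norm_scaleR_le: "bmat_norm (\<lambda>i j. r *\<^sub>R A i j) \<le> \<bar>r\<bar> * bmat_norm A"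
proof -
  have "L2_set (\<lambda>i. norm (\<Sum>j\<in>S. r *\<^sub>R A i j * x j)) S \<le> \<bar>r\<bar> * bmat_norm A"
    if S: "finite S" and x: "L2_set (\<lambda>j. norm (x j)) S \<le> 1" for S x
  proof -
    have "(\<Sum>j\<in>S. r *\<^sub>R A i j * x j) = r *\<^sub>R (\<Sum>j\<in>S. A i j * x j)" for i
      by (simp add: scaleR_sum_right)
    then have "L2_set (\<lambda>i. norm (\<Sum>j\<in>S. r *\<^sub>R A i j * x j)) S
        = \<bar>r\<bar> * L2_set (\<lambda>i. norm (\<Sum>j\<in>S. A i j * x j)) S"
      by (simp add: L2_set_right_distrib)
    also have "\<dots> \<le> \<bar>r\<bar> * bmat_norm A"
      using submat_onorm_upper[OF S x, of A] submat_onorm_le_bmat_norm[OF A S]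
      by (intro mult_left_mono) auto
    finally show ?thesis .
  qed
  from bmat_bound[OF this]
  show "(\<lambda>i j. r *\<^sub>R A i j) \<in> bmat" "bmat_norm (\<lambda>i j. r *\<^sub>R A i j) \<le> \<bar>r\<bar> * bmat_norm A"
    by auto
qed

lemma bmat_norm_scaleR:
  fixes A :: "'i \<Rightarrow> 'i \<Rightarrow> 'f::real_normed_div_algebra"
  assumes A: "A \<in> bmat"
  shows "bmat_norm (\<lambda>i j. r *\<^sub>R A i j) = \<bar>r\<bar> * bmat_norm A"
proof (cases "r = 0")
  case True
  then show ?thesis
    using bmat_norm_scaleR_le[OF A, of r] bmat_norm_nonneg[OF bmat_zero, where 'b = 'f and 'a = 'i]
    by simp
next
  case False
  have "bmat_norm A \<le> \<bar>inverse r\<bar> * bmat_norm (\<lambda>i j. r *\<^sub>R A i j)"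
    using bmat_norm_scaleR_le[OF bmat_scaleR[OF A, of r], of "inverse r"] False by simp
  then show ?thesis
    using bmat_norm_scaleR_le[OF A, of r] False by (simp add: field_simps abs_inverse)
qed

lemma
  shows bmat_one: "(\<lambda>i j. if i = j then 1 else 0) \<in>
      (bmat :: ('i \<Rightarrow> 'i \<Rightarrow> 'f::real_normed_div_algebra) set)"
    and bmat_norm_one_le: "bmat_norm (\<lambda>i j :: 'i. if i = j then 1 else 0 :: 'f) \<le> 1"
proof -
  have "L2_set (\<lambda>i. norm (\<Sum>j\<in>S. (if i = j then 1 else 0) * x j)) S \<le> 1"
    if S: "finite S" and x: "L2_set (\<lambda>j. norm (x j)) S \<le> 1" for S and x :: "'i \<Rightarrow> 'f"
  proof -
    have "L2_set (\<lambda>i. norm (\<Sum>j\<in>S. (if i = j then 1 else 0) * x j)) S = L2_set (\<lambda>j. norm (x j)) S"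
      using S by (intro L2_set_cong) (simp_all add: if_distrib[of "\<lambda>c. c * _"] cong: if_cong)
    then show ?thesis
      using x by simp
  qed
  from bmat_bound[OF this]
  show "(\<lambda>i j. if i = j then 1 else 0) \<in> (bmat :: ('i \<Rightarrow> 'i \<Rightarrow> 'f) set)"
    "bmat_norm (\<lambda>i j :: 'i. if i = j then 1 else 0 :: 'f) \<le> 1"
    by auto
qed

lemma norm_entry_le_bmat_norm:
  "A \<in> bmat \<Longrightarrow> norm (A i j) \<le> bmat_norm A"
  using norm_entry_le_submat_onorm[of "{i, j}" i j A] submat_onorm_le_bmat_norm[of A "{i, j}"]
  by simp

instantiation bop :: (type, "{real_normed_div_algebra, banach}") real_normed_algebra_1
begin

lift_definition zero_bop :: "('a, 'b) bop" is "\<lambda>_ _. 0" by (rule bmat_zero)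
lift_definition one_bop :: "('a, 'b) bop" is "\<lambda>i j. if i = j then 1 else 0" by (rule bmat_one)
lift_definition plus_bop :: "('a, 'b) bop \<Rightarrow> ('a, 'b) bop \<Rightarrow> ('a, 'b) bop"
  is "\<lambda>A B i j. A i j + B i j" by (rule bmat_add)
lift_definition minus_bop :: "('a, 'b) bop \<Rightarrow> ('a, 'b) bop \<Rightarrow> ('a, 'b) bop"
  is "\<lambda>A B i j. A i j - B i j" by (rule bmat_diff)
lift_definition uminus_bop :: "('a, 'b) bop \<Rightarrow> ('a, 'b) bop" is "\<lambda>A i j. - A i j" by (rule bmat_uminus)
lift_definition scaleR_bop :: "real \<Rightarrow> ('a, 'b) bop \<Rightarrow> ('a, 'b) bop"
  is "\<lambda>r A i j. r *\<^sub>R A i j" by (rule bmat_scaleR)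
lift_definition times_bop :: "('a, 'b) bop \<Rightarrow> ('a, 'b) bop \<Rightarrow> ('a, 'b) bop"
  is "\<lambda>A B i j. \<Sum>\<^sub>\<infinity>k. A i k * B k j" by (rule bmat_times)
lift_definition norm_bop :: "('a, 'b) bop \<Rightarrow> real" is bmat_norm .
definition dist_bop :: "('a, 'b) bop \<Rightarrow> ('a, 'b) bop \<Rightarrow> real" where "dist_bop A B = norm (A - B)"
definition sgn_bop :: "('a, 'b) bop \<Rightarrow> ('a, 'b) bop" where "sgn_bop A = inverse (norm A) *\<^sub>R A"
definition [code del]: "(uniformity :: (('a, 'b) bop \<times> ('a, 'b) bop) filter) =
  (INF e\<in>{0<..}. principal {(x, y). dist x y < e})"
definition [code del]: "open (U :: ('a, 'b) bop set) \<longleftrightarrow>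
   (\<forall>x\<in>U. eventually (\<lambda>(x', y). x' = x \<longrightarrow> y \<in> U) uniformity)"

instance
proof
  fix A B C :: "('a, 'b) bop" and r s :: real
  show "A + B + C = A + (B + C)" "A + B = B + A" "0 + A = A" "- A + A = 0" "A - B = A + - B"
    "r *\<^sub>R (A + B) = r *\<^sub>R A + r *\<^sub>R B" "(r + s) *\<^sub>R A = r *\<^sub>R A + s *\<^sub>R A"
    "r *\<^sub>R s *\<^sub>R A = (r * s) *\<^sub>R A" "1 *\<^sub>R A = A"
    by (transfer; simp add: algebra_simps)+
  show "A * B * C = A * (B * C)"
    by transfer (intro ext bmat_bilinear_assoc[OF _ bmat_row_l2_bounded bmat_column_l2_bounded])
  have summable: "(\<lambda>k. X i k * Y k j) summable_on UNIV" if "X \<in> bmat" "Y \<in> bmat"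
    for X Y :: "'a \<Rightarrow> 'a \<Rightarrow> 'b" and i j
    by (rule l2_bounded_summable_mult[OF bmat_row_l2_bounded bmat_column_l2_bounded]) fact+
  show "(A + B) * C = A * C + B * C" "A * (B + C) = A * B + A * C"
    by (transfer; simp add: distrib_left distrib_right infsum_add summable)+
  show "r *\<^sub>R A * B = r *\<^sub>R (A * B)" "A * r *\<^sub>R B = r *\<^sub>R (A * B)"
    by (transfer; simp add: infsum_scaleR_right)+
  show "1 * A = A"
  proof transfer
    fix X :: "'a \<Rightarrow> 'a \<Rightarrow> 'b"
    have "(\<Sum>\<^sub>\<infinity>k. (if i = k then 1 else 0) * X k j) = (\<Sum>\<^sub>\<infinity>k\<in>{i}. X k j)" for i j
      by (rule infsum_cong_neutral) auto
    then show "(\<lambda>i j. \<Sum>\<^sub>\<infinity>k. (if i = k then 1 else 0) * X k j) = X"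
      by simp
  qed
  show "A * 1 = A"
  proof transfer
    fix X :: "'a \<Rightarrow> 'a \<Rightarrow> 'b"
    have "(\<Sum>\<^sub>\<infinity>k. X i k * (if k = j then 1 else 0)) = (\<Sum>\<^sub>\<infinity>k\<in>{j}. X i k)" for i j
      by (rule infsum_cong_neutral) auto
    then show "(\<lambda>i j. \<Sum>\<^sub>\<infinity>k. X i k * (if k = j then 1 else 0)) = X"
      by simp
  qed
  show "(0 :: ('a, 'b) bop) \<noteq> 1"
    by transfer (auto simp: fun_eq_iff)
  show "dist A B = norm (A - B)" "sgn A = inverse (norm A) *\<^sub>R A"
    by (rule dist_bop_def sgn_bop_def)+
  show "(uniformity :: (('a, 'b) bop \<times> ('a, 'b) bop) filter) =
      (INF e\<in>{0<..}. principal {(x, y). dist x y < e})"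
    by (rule uniformity_bop_def)
  show "open U \<longleftrightarrow> (\<forall>x\<in>U. eventually (\<lambda>(x', y). x' = x \<longrightarrow> y \<in> U) uniformity)"
    for U :: "('a, 'b) bop set"
    by (rule open_bop_def)
  show scale: "norm (r *\<^sub>R A) = \<bar>r\<bar> * norm A" for r and A :: "('a, 'b) bop"
    by transfer (rule bmat_norm_scaleR)
  show "norm A = 0 \<longleftrightarrow> A = 0"
  proof
    assume "norm A = 0"
    then show "A = 0"
    proof transfer
      fix X :: "'a \<Rightarrow> 'a \<Rightarrow> 'b"
      assume "X \<in> bmat" "bmat_norm X = 0"
      then have "norm (X i j) \<le> 0" for i j
        using norm_entry_le_bmat_norm[of X i j] by simp
      then show "X = (\<lambda>_ _. 0)"
        by (intro ext) simp
    qed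
  next
    have "0 *\<^sub>R (0 :: ('a, 'b) bop) = 0"
      by transfer simp
    moreover assume "A = 0"
    ultimately show "norm A = 0"
      using scale[of 0 "0 :: ('a, 'b) bop"] by simp
  qed
  show "norm (A + B) \<le> norm A + norm B"
  proof transfer
    fix X Y :: "'a \<Rightarrow> 'a \<Rightarrow> 'b"
    assume X: "X \<in> bmat" and Y: "Y \<in> bmat"
    show "bmat_norm (\<lambda>i j. X i j + Y i j) \<le> bmat_norm X + bmat_norm Y"
    proof (rule bmat_norm_le)
      fix S :: "'a set" assume S: "finite S"
      have "submat_onorm S (\<lambda>i j. X i j + Y i j) \<le> submat_onorm S X + submat_onorm S Y"
        using submat_onorm_diff_triangle[OF S, of X "\<lambda>i j. - Y i j" "\<lambda>_ _. 0"]
        by simp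
      then show "submat_onorm S (\<lambda>i j. X i j + Y i j) \<le> bmat_norm X + bmat_norm Y"
        using submat_onorm_le_bmat_norm[OF X S] submat_onorm_le_bmat_norm[OF Y S] by linarith
    qed
  qed
  show "norm (A * B) \<le> norm A * norm B"
    by transfer (rule bmat_norm_times_le)
  show "norm (1 :: ('a, 'b) bop) = 1"
  proof (rule antisym)
    show "norm (1 :: ('a, 'b) bop) \<le> 1"
      by transfer (rule bmat_norm_one_le)
    show "1 \<le> norm (1 :: ('a, 'b) bop)"
      by transfer (use norm_entry_le_bmat_norm[OF bmat_one, of undefined undefined] in simp)
  qed
qed

end

lemma bop_eqI: "(\<And>i j. entry A i j = entry B i j) \<Longrightarrow> A = B"
  by (metis entry_inject ext)

lemma entry_simps [simp]:
  "entry (A + B) i j = entry A i j + entry B i j"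
  "entry (A - B) i j = entry A i j - entry B i j"
  "entry (r *\<^sub>R A) i j = r *\<^sub>R entry A i j"
  "entry 0 i j = 0"
  by (transfer; simp)+

lemma bmat_matrix_unit: "(\<lambda>k l. if k = i \<and> l = j then c else 0) \<in> bmat"
proof (rule bmat_bound[where K = "norm c"])
  fix S and x :: "'a \<Rightarrow> 'b"
  assume S: "finite S" and x: "L2_set (\<lambda>j. norm (x j)) S \<le> 1"
  have "norm (x j) \<le> 1" if "j \<in> S"
    using member_le_L2_set[OF S that, of "\<lambda>j. norm (x j)"] x by simp
  then have "norm (\<Sum>l\<in>S. (if k = i \<and> l = j then c else 0) * x l) \<le> (if k = i then norm c else 0)" for k
    using S by (auto simp: if_distrib[of "\<lambda>c. c * _"] norm_mult mult_left_le cong: if_cong)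
  then have "L2_set (\<lambda>k. norm (\<Sum>l\<in>S. (if k = i \<and> l = j then c else 0) * x l)) S
      \<le> L2_set (\<lambda>k. if k = i then norm c else 0) S"
    by (intro L2_set_mono) auto
  also have "\<dots> \<le> (\<Sum>k\<in>S. if k = i then norm c else 0)"
    by (rule L2_set_le_sum) simp
  also have "\<dots> \<le> norm c"
    using S by simp
  finally show "L2_set (\<lambda>k. norm (\<Sum>l\<in>S. (if k = i \<and> l = j then c else 0) * x l)) S \<le> norm c" .
qed

lift_definition matrix_unit ::
    "'f \<Rightarrow> 'i \<Rightarrow> 'i \<Rightarrow> ('i, 'f::{real_normed_div_algebra, banach}) bop"
  is "\<lambda>c i j k l. if k = i \<and> l = j then c else 0"
  by (rule bmat_matrix_unit)

lemma entry_matrix_unit [simp]: "entry (matrix_unit c i j) k l = (if k = i \<and> l = j then c else 0)"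
  by transfer simp

lemma entry_matrix_unit_times [simp]:
  "entry (matrix_unit c i j * A) k l = (if k = i then c * entry A j l else 0)"
proof transfer
  fix A :: "'b \<Rightarrow> 'b \<Rightarrow> 'a" and c i j k l
  have "(\<Sum>\<^sub>\<infinity>m. (if k = i \<and> m = j then c else 0) * A m l) =
      (\<Sum>\<^sub>\<infinity>m\<in>{j}. if k = i then c * A m l else 0)"
    by (rule infsum_cong_neutral) auto
  then show "(\<Sum>\<^sub>\<infinity>m. (if k = i \<and> m = j then c else 0) * A m l) = (if k = i then c * A j l else 0)"
    by simp
qed

lemma entry_times_matrix_unit [simp]:
  "entry (A * matrix_unit c i j) k l = (if l = j then entry A k i * c else 0)"
proof transfer
  fix A :: "'b \<Rightarrow> 'b \<Rightarrow> 'a" and c i j k l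
  have "(\<Sum>\<^sub>\<infinity>m. A k m * (if m = i \<and> l = j then c else 0)) =
      (\<Sum>\<^sub>\<infinity>m\<in>{i}. if l = j then A k m * c else 0)"
    by (rule infsum_cong_neutral) auto
  then show "(\<Sum>\<^sub>\<infinity>m. A k m * (if m = i \<and> l = j then c else 0)) = (if l = j then A k i * c else 0)"
    by simp
qed

lemma entry_times_matrix_unit_times:
  "entry (A * matrix_unit c j k * B) i l = entry A i j * c * entry B k l"
proof -
  have "matrix_unit 1 i i * (A * matrix_unit c j k * B) = matrix_unit (entry A i j * c) i k * B"
    unfolding mult.assoc[symmetric]
    by (intro arg_cong[where f = "\<lambda>X. X * B"] bop_eqI) simp
  from arg_cong[where f = "\<lambda>X. entry X i l", OF this] show ?thesis
    by simp
qed

text \<open>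
  A nonzero entry of \<open>A\<close> and a nonzero entry of \<open>B\<close> are linked by a matrix unit.
\<close>

lemma bop_prime:
  fixes A B :: "('i, 'f::{real_normed_div_algebra, banach}) bop"
  assumes "\<And>X. A * X * B = 0"
  shows "A = 0 \<or> B = 0"
proof (rule ccontr)
  assume "\<not> (A = 0 \<or> B = 0)"
  then obtain i j k l where "entry A i j \<noteq> 0" "entry B k l \<noteq> 0"
    by (metis bop_eqI entry_simps(4))
  then show False
    using assms[of "matrix_unit 1 j k"] entry_times_matrix_unit_times[of A 1 j k B i l] by simp
qed

section \<open>Two-local derivations of bounded matrices\<close>

text \<open>
  The notions of derivation and of 2-local derivation for algebras that are types rather than records.
\<close>

definition real_derivation :: "('a::real_algebra \<Rightarrow> 'a) \<Rightarrow> bool" where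
  "real_derivation D \<longleftrightarrow> linear D \<and> (\<forall>x y. D (x * y) = D x * y + x * D y)"

definition real_two_local_derivation :: "('a::real_algebra \<Rightarrow> 'a) \<Rightarrow> bool" where
  "real_two_local_derivation \<Delta> \<longleftrightarrow>
     (\<forall>x y. \<exists>D. real_derivation D \<and> \<Delta> x = D x \<and> \<Delta> y = D y)"

lemma real_derivationD:
  assumes "real_derivation D"
  shows "linear D" "D (x + y) = D x + D y" "D (r *\<^sub>R x) = r *\<^sub>R D x" "D 0 = 0"
    "D (x * y) = D x * y + x * D y"
  using assms by (auto simp: real_derivation_def linear_add linear_scale linear_0)

lemma real_derivation_one: "real_derivation D \<Longrightarrow> D (1::'a::real_algebra_1) = 0"
  using real_derivationD(5)[of D 1 1] by simp

text \<open>
  What the argument requires of the scalars: a real-valued trace that vanishes on the values of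
  every derivation of \<open>'f\<close>. It serves to test matrix entries, since \<open>tr (\<mu> * a) = 0\<close> for all
  \<open>\<mu>\<close> forces \<open>a = 0\<close>.
\<close>

locale derivation_null_trace =
  fixes tr :: "'f::{real_normed_div_algebra, banach} \<Rightarrow> real"
  assumes linear_tr: "linear tr"
    and tr_commute: "tr (a * b) = tr (b * a)"
    and tr_one: "tr 1 \<noteq> 0"
    and tr_derivation: "real_derivation d \<Longrightarrow> tr (d a) = 0"
begin

lemma tr_simps: "tr (a + b) = tr a + tr b" "tr (a - b) = tr a - tr b" "tr 0 = 0"
  by (simp_all add: linear_tr linear_add linear_diff linear_0)

lemma tr_nondegenerate: "(\<And>\<mu>. tr (\<mu> * a) = 0) \<Longrightarrow> a = 0"
  by (metis left_inverse tr_one)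

text \<open>
  With \<open>E\<close> the diagonal matrix unit at \<open>j\<close>, the corner \<open>E z E\<close> is a copy of the scalars on which the
  \<open>(j, j)\<close> entry of \<open>D\<close> is a derivation, so the trace kills it. Expanding
  \<open>D (E z E)\<close> as the derivative of the product of \<open>E z\<close> and \<open>E\<close> relates the remaining two terms.
\<close>

lemma tr_derivation_corner:
  fixes D :: "('i, 'f) bop \<Rightarrow> ('i, 'f) bop"
  assumes D: "real_derivation D"
  shows "tr (entry (D (matrix_unit 1 j j * z)) j j) = - tr (entry (z * D (matrix_unit 1 j j)) j j)"
proof -
  define E :: "('i, 'f) bop" where "E = matrix_unit 1 j j"
  define d where "d c = entry (D (matrix_unit c j j)) j j" for c
  have "real_derivation d"
    unfolding real_derivation_def
  proof (intro conjI linearI allI)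
    fix a b :: 'f and r :: real
    have "matrix_unit (a + b) j j = matrix_unit a j j + matrix_unit b j j"
      "matrix_unit (r *\<^sub>R a) j j = r *\<^sub>R matrix_unit a j j"
      "matrix_unit (a * b) j j = matrix_unit a j j * matrix_unit b j j"
      by (auto intro!: bop_eqI)
    then show "d (a + b) = d a + d b" "d (r *\<^sub>R a) = r *\<^sub>R d a" "d (a * b) = d a * b + a * d b"
      by (simp_all add: d_def real_derivationD[OF D])
  qed
  then have "tr (d (entry z j j)) = 0"
    by (rule tr_derivation)
  moreover have "matrix_unit (entry z j j) j j = E * z * E"
    by (rule bop_eqI) (simp add: E_def)
  ultimately have "tr (entry (D (E * z * E)) j j) = 0"
    by (simp add: d_def)
  moreover have "D (E * z * E) = D (E * z) * E + E * (z * D E)"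
    using real_derivationD(5)[OF D, of "E * z" E] by (simp add: mult.assoc)
  ultimately show ?thesis
    by (simp add: E_def tr_simps)
qed

text \<open>
  The right-hand side is \<open>- trace (x * D y)\<close> in disguise: the derivative of \<open>y = E y\<close> lives in
  row \<open>j\<close> and column \<open>i\<close>, so the trace of \<open>x * D y\<close> is made up of a row part \<open>(D y * x)\<^sub>j\<^sub>j\<close> and a
  column part \<open>(x * D y)\<^sub>i\<^sub>i\<close>, which count the entry \<open>(D y)\<^sub>j\<^sub>i\<close> twice. It
  depends on \<open>D\<close> through \<open>D y\<close> only and is additive in \<open>x\<close>. The proof computes the \<open>(j, j)\<close> entry of
  \<open>D (y x) = D (E y x)\<close> in two ways.
\<close>

lemma tr_derivation_entry:
  fixes D :: "('i, 'f) bop \<Rightarrow> ('i, 'f) bop" and \<mu> :: 'f and i j :: 'i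
  assumes D: "real_derivation D"
  defines "y \<equiv> matrix_unit \<mu> j i"
  shows "tr (\<mu> * entry (D x) i j) =
    tr (entry x i j * entry (D y) j i) - tr (entry (D y * x) j j) - tr (entry (x * D y) i i)"
proof -
  define E :: "('i, 'f) bop" where "E = matrix_unit 1 j j"
  have Ey: "E * y = y"
    by (rule bop_eqI) (simp add: E_def y_def)
  have "D y = D E * y + E * D y"
    using real_derivationD(5)[OF D, of E y] unfolding Ey .
  then have "D E * y = D y - E * D y"
    by (metis add_diff_cancel_right')
  then have DEy: "x * D E * y = x * D y - x * E * D y"
    by (simp add: mult.assoc right_diff_distrib)
  have "tr (entry (D (y * x)) j j) = tr (entry (D (E * (y * x))) j j)"
    by (simp add: Ey flip: mult.assoc)
  also have "\<dots> = - tr (entry (y * (x * D E)) j j)"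
    using tr_derivation_corner[OF D, of j "y * x"] by (simp add: E_def mult.assoc)
  also have "\<dots> = - tr (entry (x * D E * y) i i)"
    by (simp add: y_def tr_commute)
  also have "\<dots> = tr (entry x i j * entry (D y) j i) - tr (entry (x * D y) i i)"
    unfolding DEy by (simp add: E_def entry_times_matrix_unit_times tr_simps)
  finally show ?thesis
    by (simp add: real_derivationD(5)[OF D] tr_simps) (simp add: y_def)
qed

text \<open>
  For a fixed test matrix \<open>y\<close>, the derivation provided for the pair \<open>z\<close>, \<open>y\<close> varies with \<open>z\<close>, but its
  value at \<open>y\<close> does not.
\<close>

lemma two_local_derivation_bop_add:
  fixes \<Delta> :: "('i, 'f) bop \<Rightarrow> ('i, 'f) bop"
  assumes \<Delta>: "real_two_local_derivation \<Delta>"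
  shows "\<Delta> (x + x') = \<Delta> x + \<Delta> x'"
proof (rule bop_eqI)
  fix i j
  have "entry (\<Delta> (x + x')) i j - entry (\<Delta> x) i j - entry (\<Delta> x') i j = 0"
  proof (rule tr_nondegenerate)
    fix \<mu> :: 'f
    define w where "w = \<Delta> (matrix_unit \<mu> j i)"
    have key: "tr (\<mu> * entry (\<Delta> z) i j) =
        tr (entry z i j * entry w j i) - tr (entry (w * z) j j) - tr (entry (z * w) i i)" for z
    proof -
      obtain D where "real_derivation D" "\<Delta> z = D z" "w = D (matrix_unit \<mu> j i)"
        using \<Delta> unfolding real_two_local_derivation_def w_def by blast
      then show ?thesis
        using tr_derivation_entry[of D \<mu> z i j] by simp
    qed
    show "tr (\<mu> * (entry (\<Delta> (x + x')) i j - entry (\<Delta> x) i j - entry (\<Delta> x') i j)) = 0"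
      by (simp add: key right_diff_distrib distrib_left distrib_right tr_simps)
  qed
  then show "entry (\<Delta> (x + x')) i j = entry (\<Delta> x + \<Delta> x') i j"
    by (simp add: algebra_simps)
qed

theorem two_local_derivation_bop:
  fixes \<Delta> :: "('i, 'f) bop \<Rightarrow> ('i, 'f) bop"
  assumes \<Delta>: "real_two_local_derivation \<Delta>"
  shows "real_derivation \<Delta>"
  unfolding real_derivation_def
proof (intro conjI linearI allI)
  fix x y :: "('i, 'f) bop" and r :: real
  show add: "\<Delta> (x + y) = \<Delta> x + \<Delta> y" for x y
    by (rule two_local_derivation_bop_add[OF \<Delta>])
  show "\<Delta> (r *\<^sub>R x) = r *\<^sub>R \<Delta> x"
    using \<Delta>[unfolded real_two_local_derivation_def, rule_format, of x "r *\<^sub>R x"]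
    by (auto simp: real_derivationD(3))
  show "\<Delta> (x * y) = \<Delta> x * y + x * \<Delta> y"
  proof (rule jordan_derivation_prime_ring)
    show "x = 0" if "x + x = 0" for x :: "('i, 'f) bop"
    proof -
      have "2 *\<^sub>R x = 0"
        using that by (simp add: scaleR_2)
      then show ?thesis
        by simp
    qed
    show "\<Delta> (x * x) = \<Delta> x * x + x * \<Delta> x" for x
      using \<Delta>[unfolded real_two_local_derivation_def, rule_format, of x "x * x"]
      by (auto simp: real_derivationD(5))
    show "a = 0 \<or> b = 0" if "\<And>x. a * x * b = 0" for a b :: "('i, 'f) bop"
      using that by (rule bop_prime)
  qed (rule add)
qed

end

section \<open>Traces on the real numbers and the quaternions\<close>

interpretation real_trace: derivation_null_trace "\<lambda>a::real. a"
proof (rule derivation_null_trace.intro)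
  fix d :: "real \<Rightarrow> real" and a :: real
  assume d: "real_derivation d"
  show "d a = 0"
    using real_derivationD(3)[OF d, of a 1] real_derivation_one[OF d] by simp
qed (simp_all add: linear_ident)

lemma abs_quat_component_le_norm:
  "\<bar>QRe p\<bar> \<le> norm p" "\<bar>QI p\<bar> \<le> norm p" "\<bar>QJ p\<bar> \<le> norm p" "\<bar>QK p\<bar> \<le> norm p"
  unfolding norm_quat_def real_sqrt_abs[symmetric] by (intro real_sqrt_le_mono; simp)+

lemma norm_quat_le: "norm p \<le> \<bar>QRe p\<bar> + \<bar>QI p\<bar> + \<bar>QJ p\<bar> + \<bar>QK p\<bar>"
proof -
  have "norm (Quat (QRe p) 0 0 0 + Quat 0 (QI p) 0 0 + Quat 0 0 (QJ p) 0 + Quat 0 0 0 (QK p))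
      \<le> norm (Quat (QRe p) 0 0 0) + norm (Quat 0 (QI p) 0 0)
        + norm (Quat 0 0 (QJ p) 0) + norm (Quat 0 0 0 (QK p))"
    by (intro norm_triangle_mono order_refl)
  also have "Quat (QRe p) 0 0 0 + Quat 0 (QI p) 0 0 + Quat 0 0 (QJ p) 0 + Quat 0 0 0 (QK p) = p"
    by (simp add: quat_eq_iff plus_quat_def)
  finally show ?thesis
    by (simp add: norm_quat_def)
qed

instance quat :: banach
proof
  fix X :: "nat \<Rightarrow> quat" assume X: "Cauchy X"
  have component: "convergent (\<lambda>n. c (X n))" if c: "\<And>p q. c (p - q) = c p - c q" "\<And>p. \<bar>c p\<bar> \<le> norm p"
    for c :: "quat \<Rightarrow> real"
  proof (intro Cauchy_convergent CauchyI)
    fix r :: real assume "0 < r"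
    from CauchyD[OF X this] obtain M where "\<forall>m\<ge>M. \<forall>n\<ge>M. norm (X m - X n) < r"
      by blast
    then have "norm (c (X m) - c (X n)) < r" if "M \<le> m" "M \<le> n" for m n
      using le_less_trans[OF c(2)[of "X m - X n"]] that by (simp add: c(1))
    then show "\<exists>M. \<forall>m\<ge>M. \<forall>n\<ge>M. norm (c (X m) - c (X n)) < r"
      by blast
  qed
  have diff: "QRe (p - q) = QRe p - QRe q" "QI (p - q) = QI p - QI q"
    "QJ (p - q) = QJ p - QJ q" "QK (p - q) = QK p - QK q" for p q
    by (simp_all add: minus_quat_def)
  note component[of QRe, OF diff(1) abs_quat_component_le_norm(1)]
    component[of QI, OF diff(2) abs_quat_component_le_norm(2)]
    component[of QJ, OF diff(3) abs_quat_component_le_norm(3)]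
    component[of QK, OF diff(4) abs_quat_component_le_norm(4)]
  then obtain a b c e where lims: "(\<lambda>n. QRe (X n)) \<longlonglongrightarrow> a" "(\<lambda>n. QI (X n)) \<longlonglongrightarrow> b"
    "(\<lambda>n. QJ (X n)) \<longlonglongrightarrow> c" "(\<lambda>n. QK (X n)) \<longlonglongrightarrow> e"
    unfolding convergent_def by blast
  have "(\<lambda>n. \<bar>QRe (X n) - a\<bar> + \<bar>QI (X n) - b\<bar> + \<bar>QJ (X n) - c\<bar> + \<bar>QK (X n) - e\<bar>) \<longlonglongrightarrow>
      \<bar>a - a\<bar> + \<bar>b - b\<bar> + \<bar>c - c\<bar> + \<bar>e - e\<bar>"
    by (intro tendsto_add tendsto_rabs tendsto_diff tendsto_const lims)
  then have "(\<lambda>n. \<bar>QRe (X n) - a\<bar> + \<bar>QI (X n) - b\<bar> + \<bar>QJ (X n) - c\<bar> + \<bar>QK (X n) - e\<bar>) \<longlonglongrightarrow> 0"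
    by simp
  moreover have "\<forall>n. norm (X n - Quat a b c e) \<le>
      \<bar>QRe (X n) - a\<bar> + \<bar>QI (X n) - b\<bar> + \<bar>QJ (X n) - c\<bar> + \<bar>QK (X n) - e\<bar>"
    using norm_quat_le[of "X _ - Quat a b c e"] by (simp add: diff)
  ultimately have "(\<lambda>n. X n - Quat a b c e) \<longlonglongrightarrow> 0"
    by (rule Lim_null_comparison[OF always_eventually, rotated])
  then have "X \<longlonglongrightarrow> Quat a b c e"
    by (rule LIM_zero_cancel)
  then show "convergent X"
    by (rule convergentI)
qed

lemma QRe_times_commute: "QRe (p * q) = QRe (q * p)"
  by (simp add: times_quat_def algebra_simps)

text \<open>
  Every unit \<open>i, j, k\<close> is half a commutator of the two others, as in \<open>i = j k = - k j\<close>. A derivation maps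
  commutators to sums of commutators, whose real part is zero.
\<close>

interpretation quat_trace: derivation_null_trace QRe
proof (rule derivation_null_trace.intro)
  show "linear QRe"
    by (rule linearI) (simp_all add: plus_quat_def scaleR_quat_def)
  show "QRe (a * b) = QRe (b * a)" for a b
    by (rule QRe_times_commute)
  show "QRe 1 \<noteq> 0"
    by (simp add: one_quat_def)
next
  fix d :: "quat \<Rightarrow> quat" and a :: quat
  assume d: "real_derivation d"
  let ?i = "Quat 0 1 0 0" and ?j = "Quat 0 0 1 0" and ?k = "Quat 0 0 0 1"
  have anti: "QRe (d p) = 0" if "p = q * r" "p = - (r * q)" for p q r
  proof -
    have "d p = d q * r + q * d r"
      unfolding that(1) by (rule real_derivationD(5)[OF d])
    then have "QRe (d p) = QRe (d q * r) + QRe (q * d r)"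
      by (simp add: plus_quat_def)
    moreover have "d p = - (d r * q + r * d q)"
      unfolding that(2)
      by (simp only: real_derivationD(5)[OF d] linear_neg[OF real_derivationD(1)[OF d]])
    then have "QRe (d p) = - (QRe (d r * q) + QRe (r * d q))"
      by (simp add: plus_quat_def uminus_quat_def)
    ultimately have "QRe (d p) = - QRe (d p)"
      using QRe_times_commute[of "d q" r] QRe_times_commute[of q "d r"] by linarith
    then show ?thesis
      by simp
  qed
  have "QRe (d ?i) = 0" "QRe (d ?j) = 0" "QRe (d ?k) = 0"
    by (rule anti[of ?i ?j ?k] anti[of ?j ?k ?i] anti[of ?k ?i ?j];
        simp add: times_quat_def uminus_quat_def)+
  moreover have "d a = QRe a *\<^sub>R d 1 + QI a *\<^sub>R d ?i + QJ a *\<^sub>R d ?j + QK a *\<^sub>R d ?k"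
  proof -
    have "d (QRe a *\<^sub>R 1 + QI a *\<^sub>R ?i + QJ a *\<^sub>R ?j + QK a *\<^sub>R ?k)
        = QRe a *\<^sub>R d 1 + QI a *\<^sub>R d ?i + QJ a *\<^sub>R d ?j + QK a *\<^sub>R d ?k"
      by (simp only: real_derivationD(2,3)[OF d])
    moreover have "QRe a *\<^sub>R 1 + QI a *\<^sub>R ?i + QJ a *\<^sub>R ?j + QK a *\<^sub>R ?k = a"
      by (simp add: quat_eq_iff one_quat_def plus_quat_def scaleR_quat_def)
    ultimately show ?thesis
      by simp
  qed
  ultimately show "QRe (d a) = 0"
    by (simp add: real_derivation_one[OF d] plus_quat_def scaleR_quat_def zero_quat_def)
qed

section \<open>Derivations of continuous families of bounded matrices\<close>

text \<open>
  Passage between functions with values in the type of bounded matrices and the elements of \<open>C_bmat Q\<close>,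
  which are extensional functions with values in the set \<open>bmat\<close>.
\<close>

definition bmat_family ::
    "'q topology \<Rightarrow> ('q \<Rightarrow> ('i, 'f::{real_normed_div_algebra, banach}) bop) \<Rightarrow> 'q \<Rightarrow> 'i \<Rightarrow> 'i \<Rightarrow> 'f"
  where "bmat_family Q F = (\<lambda>q\<in>topspace Q. entry (F q))"

definition bop_family ::
    "('q \<Rightarrow> 'i \<Rightarrow> 'i \<Rightarrow> 'f) \<Rightarrow> 'q \<Rightarrow> ('i, 'f::{real_normed_div_algebra, banach}) bop"
  where "bop_family f q = Bop (f q)"

lemma bmat_family_apply: "q \<in> topspace Q \<Longrightarrow> bmat_family Q F q = entry (F q)"
  by (simp add: bmat_family_def)

lemma bop_family_bmat_family [simp]: "q \<in> topspace Q \<Longrightarrow> bop_family (bmat_family Q F) q = F q"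
  by (simp add: bop_family_def bmat_family_def entry_inverse)

lemma bmat_family_cong:
  "(\<And>q. q \<in> topspace Q \<Longrightarrow> F q = G q) \<Longrightarrow> bmat_family Q F = bmat_family Q G"
  by (auto simp: bmat_family_def)

lemma bmat_dist_entry: "bmat_dist (entry A) (entry B) = dist A B"
  by (simp add: bmat_dist_def entry dist_norm norm_bop.rep_eq minus_bop.rep_eq)

lemma continuous_map_bmat_family:
  fixes F :: "'q \<Rightarrow> ('i, 'f::{real_normed_div_algebra, banach}) bop"
  shows "continuous_map Q bmat_topology (bmat_family Q F) \<longleftrightarrow> continuous_map Q euclidean F"
proof -
  interpret Metric_space "bmat :: ('i \<Rightarrow> 'i \<Rightarrow> 'f) set" bmat_dist
    by (rule Metric_space_bmat)
  have "limitin bmat_topology (bmat_family Q F) (bmat_family Q F q) (atin Q q) \<longleftrightarrow>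
      (F \<longlongrightarrow> F q) (atin Q q)" if q: "q \<in> topspace Q" for q
  proof -
    have "(\<forall>\<^sub>F p in atin Q q. bmat_family Q F p \<in> bmat \<and>
          bmat_dist (bmat_family Q F p) (bmat_family Q F q) < e) \<longleftrightarrow>
        (\<forall>\<^sub>F p in atin Q q. dist (F p) (F q) < e)" for e
    proof (rule eventually_cong)
      show "\<forall>\<^sub>F p in atin Q q. p \<in> topspace Q"
        using q by (auto simp: eventually_atin)
    qed (simp add: bmat_family_apply q entry bmat_dist_entry)
    then show ?thesis
      by (simp add: bmat_topology_def limitin_metric tendsto_iff bmat_family_apply q entry)
  qed
  then show ?thesis
    by (simp add: continuous_map_atin)
qed

lemma bmat_family_in_carrier:
  "bmat_family Q F \<in> carrier (C_bmat Q) \<longleftrightarrow> continuous_map Q euclidean F"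
  by (simp add: C_bmat_def cont_alg_def continuous_map_bmat_family) (simp add: bmat_family_def)

lemma bmat_family_bop_family:
  fixes f :: "'q \<Rightarrow> 'i \<Rightarrow> 'i \<Rightarrow> 'f::{real_normed_div_algebra, banach}"
  assumes "f \<in> carrier (C_bmat Q)"
  shows "bmat_family Q (bop_family f) = f"
proof (rule extensionalityI[of _ "topspace Q"])
  fix q assume q: "q \<in> topspace Q"
  interpret Metric_space "bmat :: ('i \<Rightarrow> 'i \<Rightarrow> 'f) set" bmat_dist
    by (rule Metric_space_bmat)
  have "f q \<in> bmat"
    using assms q by (auto simp: C_bmat_def cont_alg_def bmat_topology_def continuous_map_def)
  then show "bmat_family Q (bop_family f) q = f q"
    using q by (simp add: bmat_family_def bop_family_def Bop_inverse)
qed (use assms in \<open>auto simp: bmat_family_def C_bmat_def cont_alg_def\<close>)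

lemma C_bmat_carrierE:
  assumes "f \<in> carrier (C_bmat Q)"
  obtains F where "continuous_map Q euclidean F" "f = bmat_family Q F"
  using bmat_family_bop_family[OF assms] bmat_family_in_carrier[of Q "bop_family f"] assms by metis

lemma bmat_family_ops:
  "bmat_family Q F \<oplus>\<^bsub>C_bmat Q\<^esub> bmat_family Q G = bmat_family Q (\<lambda>q. F q + G q)"
  "bmat_family Q F \<otimes>\<^bsub>C_bmat Q\<^esub> bmat_family Q G = bmat_family Q (\<lambda>q. F q * G q)"
  "r \<odot>\<^bsub>C_bmat Q\<^esub> bmat_family Q F = bmat_family Q (\<lambda>q. r *\<^sub>R F q)"
  by (auto simp: C_bmat_def cont_alg_def bmat_alg_def bmat_family_def fun_eq_iff
      plus_bop.rep_eq times_bop.rep_eq scaleR_bop.rep_eq)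

lemma continuous_map_euclidean_iff:
  "continuous_map Q euclidean F \<longleftrightarrow> (\<forall>q\<in>topspace Q. (F \<longlongrightarrow> F q) (atin Q q))"
  by (simp add: continuous_map_atin)

lemma bop_family_ops:
  assumes "f \<in> carrier (C_bmat Q)" "q \<in> topspace Q"
  shows "g \<in> carrier (C_bmat Q) \<Longrightarrow>
      bop_family (f \<oplus>\<^bsub>C_bmat Q\<^esub> g) q = bop_family f q + bop_family g q"
    and "g \<in> carrier (C_bmat Q) \<Longrightarrow>
      bop_family (f \<otimes>\<^bsub>C_bmat Q\<^esub> g) q = bop_family f q * bop_family g q"
    and "bop_family (r \<odot>\<^bsub>C_bmat Q\<^esub> f) q = r *\<^sub>R bop_family f q"
  using assms by (auto elim!: C_bmat_carrierE simp: bmat_family_ops)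

lemma C_bmat_times_closed:
  fixes f g :: "'q \<Rightarrow> 'i \<Rightarrow> 'i \<Rightarrow> 'f::{real_normed_div_algebra, banach}"
  assumes "f \<in> carrier (C_bmat Q)" "g \<in> carrier (C_bmat Q)"
  shows "f \<otimes>\<^bsub>C_bmat Q\<^esub> g \<in> carrier (C_bmat Q)"
proof -
  obtain F G where "continuous_map Q euclidean F" "f = bmat_family Q F"
    "continuous_map Q euclidean G" "g = bmat_family Q G"
    using assms by (elim C_bmat_carrierE)
  then show ?thesis
    by (auto simp: bmat_family_ops bmat_family_in_carrier continuous_map_euclidean_iff
        intro!: tendsto_intros)
qed

lemma derivationD:
  assumes "derivation A D" "x \<in> carrier A"
  shows "D x \<in> carrier A"
    "y \<in> carrier A \<Longrightarrow> D (x \<oplus>\<^bsub>A\<^esub> y) = D x \<oplus>\<^bsub>A\<^esub> D y"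
    "D (r \<odot>\<^bsub>A\<^esub> x) = r \<odot>\<^bsub>A\<^esub> D x"
    "y \<in> carrier A \<Longrightarrow> D (x \<otimes>\<^bsub>A\<^esub> y) = D x \<otimes>\<^bsub>A\<^esub> y \<oplus>\<^bsub>A\<^esub> x \<otimes>\<^bsub>A\<^esub> D y"
  using assms by (auto simp: derivation_def)

text \<open>
  The factors are the scalar \<open>\<parallel>F\<parallel>\<^sup>1\<^sup>/\<^sup>2\<close> and \<open>F / \<parallel>F\<parallel>\<^sup>1\<^sup>/\<^sup>2\<close>. The second one has norm \<open>\<parallel>F\<parallel>\<^sup>1\<^sup>/\<^sup>2\<close>, which
  gives its continuity at the zeros of \<open>F\<close>.
\<close>

lemma continuous_factorization_vanishing:
  fixes F :: "'q \<Rightarrow> 'a::real_normed_algebra_1"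
  assumes F: "continuous_map Q euclidean F"
  obtains G H where "continuous_map Q euclidean G" "continuous_map Q euclidean H"
    "F = (\<lambda>p. G p * H p)" "\<And>p. F p = 0 \<Longrightarrow> G p = 0 \<and> H p = 0"
proof
  define s where "s p = sqrt (norm (F p))" for p
  define G :: "'q \<Rightarrow> 'a" where "G p = of_real (s p)" for p
  define H where "H p = F p /\<^sub>R s p" for p
  have F_lim: "(F \<longlongrightarrow> F q) (atin Q q)" if "q \<in> topspace Q" for q
    using F that by (simp add: continuous_map_euclidean_iff)
  then have s_lim: "(s \<longlongrightarrow> s q) (atin Q q)" if "q \<in> topspace Q" for q
    unfolding s_def using that by (intro tendsto_intros)
  then show "continuous_map Q euclidean G"
    unfolding continuous_map_euclidean_iff G_def by (intro ballI tendsto_intros)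
  have norm_H: "norm (H p) = s p" for p
    by (simp add: H_def s_def real_div_sqrt divide_inverse_commute[symmetric])
  show "continuous_map Q euclidean H"
    unfolding continuous_map_euclidean_iff
  proof
    fix q assume q: "q \<in> topspace Q"
    show "(H \<longlongrightarrow> H q) (atin Q q)"
    proof (cases "F q = 0")
      case True
      have "(s \<longlongrightarrow> 0) (atin Q q)"
        using s_lim[OF q] True by (simp add: s_def)
      then have "(H \<longlongrightarrow> 0) (atin Q q)"
        by (subst tendsto_norm_zero_iff[symmetric]) (simp add: norm_H)
      then show ?thesis
        using True by (simp add: H_def)
    next
      case False
      then show ?thesis
        unfolding H_def using q by (intro tendsto_intros F_lim s_lim) (auto simp: s_def)
    qed
  qed
  show "F = (\<lambda>p. G p * H p)"
  proof
    fix p show "F p = G p * H p"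
      by (cases "F p = 0") (simp_all add: G_def H_def s_def of_real_def)
  qed
  show "G p = 0 \<and> H p = 0" if "F p = 0" for p
    using that by (simp add: G_def H_def s_def)
qed

text \<open>
  \<open>F - F q\<close> is a product of two families that vanish at \<open>q\<close>, so by the Leibniz rule \<open>D\<close> maps it to a family
  that vanishes at \<open>q\<close>; hence \<open>D F\<close> agrees at \<open>q\<close> with \<open>D\<close> of the constant family \<open>F q\<close>.
\<close>

lemma derivation_C_bmat_pointwise:
  fixes Q :: "'q topology"
    and D :: "('q \<Rightarrow> 'i \<Rightarrow> 'i \<Rightarrow> 'f::{real_normed_div_algebra, banach}) \<Rightarrow> ('q \<Rightarrow> 'i \<Rightarrow> 'i \<Rightarrow> 'f)"
  assumes D: "derivation (C_bmat Q) D" and q: "q \<in> topspace Q"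
  obtains d where "real_derivation d"
    "\<And>F. continuous_map Q euclidean F \<Longrightarrow> bop_family (D (bmat_family Q F)) q = d (F q)"
proof
  define \<delta> where "\<delta> F = bop_family (D (bmat_family Q F)) q" for F
  define d where "d x = \<delta> (\<lambda>_. x)" for x
  have \<delta>_add: "\<delta> (\<lambda>p. F p + G p) = \<delta> F + \<delta> G"
    and \<delta>_times: "\<delta> (\<lambda>p. F p * G p) = \<delta> F * G q + F q * \<delta> G"
    and \<delta>_scale: "\<delta> (\<lambda>p. r *\<^sub>R F p) = r *\<^sub>R \<delta> F"
    if "continuous_map Q euclidean F" "continuous_map Q euclidean G" for F G r
  proof -
    note FG = that[folded bmat_family_in_carrier]
    note closed = derivationD(1)[OF D FG(1)] derivationD(1)[OF D FG(2)]
    show "\<delta> (\<lambda>p. F p + G p) = \<delta> F + \<delta> G"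
      unfolding \<delta>_def bmat_family_ops[symmetric] derivationD(2)[OF D FG]
      by (rule bop_family_ops(1)[OF closed(1) q closed(2)])
    show "\<delta> (\<lambda>p. r *\<^sub>R F p) = r *\<^sub>R \<delta> F"
      unfolding \<delta>_def bmat_family_ops[symmetric] derivationD(3)[OF D FG(1)]
      by (rule bop_family_ops(3)[OF closed(1) q])
    show "\<delta> (\<lambda>p. F p * G p) = \<delta> F * G q + F q * \<delta> G"
      unfolding \<delta>_def bmat_family_ops[symmetric] derivationD(4)[OF D FG]
      using FG closed q by (simp add: bop_family_ops C_bmat_times_closed)
  qed
  show "real_derivation d"
    unfolding real_derivation_def d_def
    by (intro conjI linearI allI) (rule \<delta>_add \<delta>_times \<delta>_scale[where G = "\<lambda>_. 0"]; simp)+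
  show "bop_family (D (bmat_family Q F)) q = d (F q)" if F: "continuous_map Q euclidean F" for F
  proof -
    let ?c = "\<lambda>_::'q. F q" and ?F\<^sub>0 = "\<lambda>p. F p - F q"
    have c: "continuous_map Q euclidean ?c"
      by simp
    have F0: "continuous_map Q euclidean ?F\<^sub>0"
      using F unfolding continuous_map_euclidean_iff by (auto intro!: tendsto_intros)
    obtain G H where GH: "continuous_map Q euclidean G" "continuous_map Q euclidean H"
      "?F\<^sub>0 = (\<lambda>p. G p * H p)" "G q = 0" "H q = 0"
    proof (rule continuous_factorization_vanishing[OF F0])
      fix G H :: "'q \<Rightarrow> ('i, 'f) bop"
      assume GH: "continuous_map Q euclidean G" "continuous_map Q euclidean H"
        "?F\<^sub>0 = (\<lambda>p. G p * H p)" and vanish: "\<And>p. ?F\<^sub>0 p = 0 \<Longrightarrow> G p = 0 \<and> H p = 0"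
      show thesis
        using that[OF GH] vanish[of q] by simp
    qed
    have "\<delta> ?F\<^sub>0 = 0"
      using \<delta>_times[OF GH(1,2)] GH(3-) by simp
    then have "\<delta> F = \<delta> ?c"
      using \<delta>_add[OF F0 c] by simp
    then show ?thesis
      by (simp add: \<delta>_def d_def)
  qed
qed

text \<open>
  The values of \<open>\<Delta>\<close> on constant families give a 2-local derivation \<open>d q\<close> of the matrix algebra at every
  point \<open>q\<close>. Testing \<open>\<Delta>\<close> on the pair \<open>F\<close> and the constant family \<open>F q\<close> shows that \<open>\<Delta> F\<close> is \<open>d q (F q)\<close>
  at \<open>q\<close>, and each \<open>d q\<close> is a derivation.
\<close>

lemma (in derivation_null_trace) two_local_derivation_C_bmat:
  fixes Q :: "'q topology" and \<Delta> :: "('q \<Rightarrow> 'i \<Rightarrow> 'i \<Rightarrow> 'f) \<Rightarrow> ('q \<Rightarrow> 'i \<Rightarrow> 'i \<Rightarrow> 'f)"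
  assumes \<Delta>: "two_local_derivation (C_bmat Q) \<Delta>"
  shows "derivation (C_bmat Q) \<Delta>"
proof -
  have local: "\<exists>d. real_derivation d \<and> bop_family (\<Delta> (bmat_family Q F)) q = d (F q) \<and>
      bop_family (\<Delta> (bmat_family Q G)) q = d (G q)"
    if q: "q \<in> topspace Q" and F: "continuous_map Q euclidean F"
      and G: "continuous_map Q euclidean G" for F G q
  proof -
    obtain D where D: "derivation (C_bmat Q) D" "\<Delta> (bmat_family Q F) = D (bmat_family Q F)"
      "\<Delta> (bmat_family Q G) = D (bmat_family Q G)"
      using \<Delta> F[folded bmat_family_in_carrier] G[folded bmat_family_in_carrier]
      unfolding two_local_derivation_def by blast
    show ?thesis
    proof (rule derivation_C_bmat_pointwise[OF D(1) q])
      fix d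
      assume "real_derivation d"
        "\<And>F. continuous_map Q euclidean F \<Longrightarrow> bop_family (D (bmat_family Q F)) q = d (F q)"
      then show ?thesis
        using F G unfolding D(2,3) by blast
    qed
  qed
  define d where "d q x = bop_family (\<Delta> (bmat_family Q (\<lambda>_. x))) q" for q x
  have d: "real_derivation (d q)" if "q \<in> topspace Q" for q
  proof (rule two_local_derivation_bop)
    show "real_two_local_derivation (d q)"
      unfolding real_two_local_derivation_def d_def
      using local[OF that, of "\<lambda>_. x" "\<lambda>_. y" for x y] by simp
  qed
  have \<Delta>_eq: "\<Delta> (bmat_family Q F) = bmat_family Q (\<lambda>q. d q (F q))"
    if F: "continuous_map Q euclidean F" for F
  proof -
    have "\<Delta> (bmat_family Q F) \<in> carrier (C_bmat Q)"
      using \<Delta> F[folded bmat_family_in_carrier] by (auto simp: two_local_derivation_def)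
    then have "\<Delta> (bmat_family Q F) = bmat_family Q (bop_family (\<Delta> (bmat_family Q F)))"
      by (simp add: bmat_family_bop_family)
    also have "\<dots> = bmat_family Q (\<lambda>q. d q (F q))"
    proof (rule bmat_family_cong)
      fix q assume q: "q \<in> topspace Q"
      from local[OF q F, of "\<lambda>_. F q"]
      show "bop_family (\<Delta> (bmat_family Q F)) q = d q (F q)"
        by (auto simp: d_def)
    qed
    finally show ?thesis .
  qed
  show ?thesis
    unfolding derivation_def
  proof (intro conjI ballI allI)
    show "\<Delta> \<in> carrier (C_bmat Q) \<rightarrow> carrier (C_bmat Q)"
      using \<Delta> by (simp add: two_local_derivation_def)
  next
    fix f g :: "'q \<Rightarrow> 'i \<Rightarrow> 'i \<Rightarrow> 'f" assume f: "f \<in> carrier (C_bmat Q)" and g: "g \<in> carrier (C_bmat Q)"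
    from f obtain F where F: "continuous_map Q euclidean F" "f = bmat_family Q F"
      by (rule C_bmat_carrierE)
    from g obtain G where G: "continuous_map Q euclidean G" "g = bmat_family Q G"
      by (rule C_bmat_carrierE)
    have FG: "continuous_map Q euclidean (\<lambda>q. F q + G q)" "continuous_map Q euclidean (\<lambda>q. F q * G q)"
      using F(1) G(1) unfolding continuous_map_euclidean_iff by (auto intro!: tendsto_intros)
    show "\<Delta> (f \<oplus>\<^bsub>C_bmat Q\<^esub> g) = \<Delta> f \<oplus>\<^bsub>C_bmat Q\<^esub> \<Delta> g"
      "\<Delta> (f \<otimes>\<^bsub>C_bmat Q\<^esub> g) = \<Delta> f \<otimes>\<^bsub>C_bmat Q\<^esub> g \<oplus>\<^bsub>C_bmat Q\<^esub> f \<otimes>\<^bsub>C_bmat Q\<^esub> \<Delta> g"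
      using F G FG by (auto simp: \<Delta>_eq bmat_family_ops intro!: bmat_family_cong
          real_derivationD(2,5)[OF d])
  next
    fix r and f :: "'q \<Rightarrow> 'i \<Rightarrow> 'i \<Rightarrow> 'f" assume "f \<in> carrier (C_bmat Q)"
    then obtain F where F: "continuous_map Q euclidean F" "f = bmat_family Q F"
      by (rule C_bmat_carrierE)
    moreover have "continuous_map Q euclidean (\<lambda>q. r *\<^sub>R F q)"
      using F(1) unfolding continuous_map_euclidean_iff by (auto intro!: tendsto_intros)
    ultimately show "\<Delta> (r \<odot>\<^bsub>C_bmat Q\<^esub> f) = r \<odot>\<^bsub>C_bmat Q\<^esub> \<Delta> f"
      by (auto simp: \<Delta>_eq bmat_family_ops intro!: bmat_family_cong real_derivationD(3)[OF d])
  qed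
qed

theorem theorem2:
  fixes Q :: "'q topology"
  assumes "compact_space Q" and "Hausdorff_space Q"
    and "infinite (UNIV :: 'i set)"
  shows "(\<forall>\<Delta> :: ('q \<Rightarrow> 'i \<Rightarrow> 'i \<Rightarrow> real) \<Rightarrow> ('q \<Rightarrow> 'i \<Rightarrow> 'i \<Rightarrow> real).
            two_local_derivation (C_bmat Q) \<Delta> \<longrightarrow> derivation (C_bmat Q) \<Delta>) \<and>
         (\<forall>\<Delta> :: ('q \<Rightarrow> 'i \<Rightarrow> 'i \<Rightarrow> quat) \<Rightarrow> ('q \<Rightarrow> 'i \<Rightarrow> 'i \<Rightarrow> quat).
            two_local_derivation (C_bmat Q) \<Delta> \<longrightarrow> derivation (C_bmat Q) \<Delta>)"
  using real_trace.two_local_derivation_C_bmat quat_trace.two_local_derivation_C_bmat by blast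

end
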